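(* Up to affine equivalence, there exist exactly two rigid affine structures on the $3$-dimensional real abelian Lie algebra. They are the structures associated with the semisimple commutative associative laws $\mu_1$ and $\mu_2$ on $\mathbb R^3$ (basis $e_1,e_2,e_3$) given as follows (products are extended by commutativity, and products not listed are zero): - $\mu_1$: $\mu_1(e_1,e_i)=e_i$ for $i=1,2,3$, $\mu_1(e_2,e_2)=e_2$, $\mu_1(e_3,e_3)=e_3$; - $\mu_2$: $\mu_2(e_1,e_i)=e_i$ for $i=1,2,3$, $\mu_2(e_2,e_2)=e_2$, $\mu_2(e_3,e_3)=e_2-e_1$.
   Context: An affine structure on a real Lie algebra $\mathfrak g$ of dimension $n$ is a Lie algebra morphism $\Psi:\mathfrak g\to\mathrm{aff}(\mathbb R^n)$, $\Psi(X)=\begin{pmatrix}A(X)&b(X)\\0&0\end{pmatrix}$, with $b:\mathfrak g\to\mathbb R^n$ a linear bijection. It corresponds to the product $X\cdot Y=b^{-1}(A(X)b(Y))$ on $\mathfrak g$, which is commutative and associative (not necessarily unitary) when $\mathfrak g$ is abelian. Conversely, a commutative associative product $\mu$ on $\mathbb R^n$ gives the affine structure $X\mapsto\begin{pmatrix}L_X&X\\0&0\end{pmatrix}$, $L_X(Y)=\mu(X,Y)$, on the abelian Lie algebra $\mathbb R^n$. Two affine structures on an abelian Lie algebra are affinely equivalent if and only if the corresponding algebras are isomorphic; this is taken as the definition of affine equivalence. Let $\mathcal A^c(n)$ be the set of commutative associative (not necessarily unitary) bilinear laws $\mu:\mathbb R^n\times\mathbb R^n\to\mathbb R^n$. It is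 identified, via structure constants $\mu(e_i,e_j)=\sum_k C_{ij}^ke_k$, with a real algebraic subset of $\mathbb R^{n^3}$ and given the induced topology. The group $GL(n,\mathbb R)$ acts on it by $\mu_f(x,y)=f^{-1}\mu(f(x),f(y))$. A law $\mu$ is rigid if its orbit under this action is open in $\mathcal A^c(n)$. An affine structure on an $n$-dimensional abelian Lie algebra is rigid if its corresponding law is rigid in $\mathcal A^c(n)$. *)

theory Defs
  imports "HOL-Analysis.Analysis"
begin

section \<open>Commutative associative laws and their rigidity\<close>

text \<open>Laws need not have a unit.\<close>

definition comm_assoc_laws :: "(real^'n \<Rightarrow> real^'n \<Rightarrow> real^'n) set" where
  "comm_assoc_laws = {\<mu>. bilinear \<mu> \<and> (\<forall>x y. \<mu> x y = \<mu> y x) \<and>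
     (\<forall>x y z. \<mu> (\<mu> x y) z = \<mu> x (\<mu> y z))}"

definition structure_constants ::
    "(real^'n \<Rightarrow> real^'n \<Rightarrow> real^'n) \<Rightarrow> real^'n^'n^'n" where
  "structure_constants \<mu> = (\<chi> i j k. \<mu> (axis i 1) (axis j 1) $ k)"

text \<open>A bilinear law is determined by its structure constants, so pulling back the Euclidean
  topology along \<^const>\<open>structure_constants\<close> is the same as identifying the set of laws with a
  subset of the space of structure constants and giving it the subspace topology.\<close>

definition law_topology :: "(real^'n \<Rightarrow> real^'n \<Rightarrow> real^'n) topology" where
  "law_topology = pullback_topology comm_assoc_laws structure_constants euclidean"

definition law_action ::
    "(real^'n \<Rightarrow> real^'n) \<Rightarrow> (real^'n \<Rightarrow> real^'n \<Rightarrow> real^'n) \<Rightarrow> real^'n \<Rightarrow> real^'n \<Rightarrow> real^'n" where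
  "law_action f \<mu> = (\<lambda>x y. inv f (\<mu> (f x) (f y)))"

definition law_orbit ::
    "(real^'n \<Rightarrow> real^'n \<Rightarrow> real^'n) \<Rightarrow> (real^'n \<Rightarrow> real^'n \<Rightarrow> real^'n) set" where
  "law_orbit \<mu> = {law_action f \<mu> |f. linear f \<and> bij f}"

definition rigid_law :: "(real^'n \<Rightarrow> real^'n \<Rightarrow> real^'n) \<Rightarrow> bool" where
  "rigid_law \<mu> \<longleftrightarrow> \<mu> \<in> comm_assoc_laws \<and> openin law_topology (law_orbit \<mu>)"

definition isomorphic_laws ::
    "('a::real_vector \<Rightarrow> 'a \<Rightarrow> 'a) \<Rightarrow> ('b::real_vector \<Rightarrow> 'b \<Rightarrow> 'b) \<Rightarrow> bool" where
  "isomorphic_laws \<mu> \<nu> \<longleftrightarrow>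
     (\<exists>f. linear f \<and> bij f \<and> (\<forall>x y. f (\<mu> x y) = \<nu> (f x) (f y)))"

section \<open>Semisimple laws\<close>

definition law_ideal :: "('a::real_vector \<Rightarrow> 'a \<Rightarrow> 'a) \<Rightarrow> 'a set \<Rightarrow> bool" where
  "law_ideal \<mu> I \<longleftrightarrow> subspace I \<and> (\<forall>a. \<forall>x\<in>I. \<mu> a x \<in> I \<and> \<mu> x a \<in> I)"

text \<open>The exponent is shifted: \<open>ideal_power \<mu> I k\<close> is the power of \<open>I\<close> with exponent \<open>k + 1\<close>,
  since in a law without unit there is no zeroth power.\<close>

primrec ideal_power :: "('a::real_vector \<Rightarrow> 'a \<Rightarrow> 'a) \<Rightarrow> 'a set \<Rightarrow> nat \<Rightarrow> 'a set" where
  "ideal_power \<mu> I 0 = I"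
| "ideal_power \<mu> I (Suc k) = span {\<mu> x y |x y. x \<in> I \<and> y \<in> ideal_power \<mu> I k}"

text \<open>Semisimplicity of a finite-dimensional associative algebra: its radical vanishes, i.e. its
  only nilpotent two-sided ideal is zero.\<close>

definition semisimple_law :: "('a::real_vector \<Rightarrow> 'a \<Rightarrow> 'a) \<Rightarrow> bool" where
  "semisimple_law \<mu> \<longleftrightarrow>
     (\<forall>I. law_ideal \<mu> I \<and> (\<exists>k. ideal_power \<mu> I k = {0}) \<longrightarrow> I = {0})"

section \<open>Affine structures\<close>

text \<open>The matrix with blocks \<open>A\<close>, \<open>b\<close> in its upper rows and a zero last row; the
  additional row and column have index \<^const>\<open>None\<close>.\<close>

definition affine_matrix :: "real^'n^'n \<Rightarrow> real^'n \<Rightarrow> real^('n option)^('n option)" where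
  "affine_matrix A b = (\<chi> i j. case i of None \<Rightarrow> 0
     | Some i' \<Rightarrow> (case j of None \<Rightarrow> b $ i' | Some j' \<Rightarrow> A $ i' $ j'))"

definition aff_algebra :: "(real^(('n::finite) option)^('n option)) set" where
  "aff_algebra = {affine_matrix A b |A b. True}"

definition linear_part :: "real^('n option)^('n option) \<Rightarrow> real^'n^'n" where
  "linear_part M = (\<chi> i j. M $ Some i $ Some j)"

definition translation_part :: "real^('n option)^('n option) \<Rightarrow> real^'n" where
  "translation_part M = (\<chi> i. M $ Some i $ None)"

definition matrix_commutator :: "real^'m^'m \<Rightarrow> real^'m^'m \<Rightarrow> real^'m^'m" where
  "matrix_commutator M N = M ** N - N ** M"

definition affine_structure ::
    "('g::real_vector \<Rightarrow> 'g \<Rightarrow> 'g) \<Rightarrow> ('g \<Rightarrow> real^(('n::finite) option)^('n option)) \<Rightarrow> bool" where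
  "affine_structure br \<Psi> \<longleftrightarrow>
     linear \<Psi> \<and> range \<Psi> \<subseteq> aff_algebra \<and>
     (\<forall>X Y. \<Psi> (br X Y) = matrix_commutator (\<Psi> X) (\<Psi> Y)) \<and>
     linear (\<lambda>X. translation_part (\<Psi> X)) \<and> bij (\<lambda>X. translation_part (\<Psi> X))"

definition affine_product ::
    "('g::real_vector \<Rightarrow> real^(('n::finite) option)^('n option)) \<Rightarrow> 'g \<Rightarrow> 'g \<Rightarrow> 'g" where
  "affine_product \<Psi> X Y =
     inv (\<lambda>Z. translation_part (\<Psi> Z)) (linear_part (\<Psi> X) *v translation_part (\<Psi> Y))"

definition affine_structure_of_law ::
    "(real^'n \<Rightarrow> real^'n \<Rightarrow> real^'n) \<Rightarrow> real^'n \<Rightarrow> real^('n option)^('n option)" where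
  "affine_structure_of_law \<mu> X = affine_matrix (matrix (\<mu> X)) X"

definition affinely_equivalent ::
    "('g::real_vector \<Rightarrow> real^(('n::finite) option)^('n option)) \<Rightarrow>
     ('g \<Rightarrow> real^('n option)^('n option)) \<Rightarrow> bool" where
  "affinely_equivalent \<Psi> \<Phi> \<longleftrightarrow> isomorphic_laws (affine_product \<Psi>) (affine_product \<Phi>)"

text \<open>The abelian Lie algebra of dimension \<open>n\<close> is realised as the coordinate space with zero
  bracket.\<close>

definition abelian_bracket :: "real^'n \<Rightarrow> real^'n \<Rightarrow> real^'n" where
  "abelian_bracket X Y = 0"

definition rigid_affine_structure ::
    "(real^'n \<Rightarrow> real^('n option)^('n option)) \<Rightarrow> bool" where
  "rigid_affine_structure \<Psi> \<longleftrightarrow>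
     affine_structure abelian_bracket \<Psi> \<and> rigid_law (affine_product \<Psi>)"

section \<open>The two semisimple laws in dimension three\<close>

definition law_of_table :: "('n \<Rightarrow> 'n \<Rightarrow> real^'n) \<Rightarrow> real^'n \<Rightarrow> real^'n \<Rightarrow> real^'n" where
  "law_of_table T x y = (\<Sum>i\<in>UNIV. \<Sum>j\<in>UNIV. (x $ i * y $ j) *\<^sub>R T i j)"

abbreviation basis3 :: "3 \<Rightarrow> real^3" where
  "basis3 i \<equiv> axis i 1"

definition mu1 :: "real^3 \<Rightarrow> real^3 \<Rightarrow> real^3" where
  "mu1 = law_of_table (\<lambda>i j.
     if i = 1 then basis3 j
     else if j = 1 then basis3 i
     else if i = 2 \<and> j = 2 then basis3 2
     else if i = 3 \<and> j = 3 then basis3 3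
     else 0)"

definition mu2 :: "real^3 \<Rightarrow> real^3 \<Rightarrow> real^3" where
  "mu2 = law_of_table (\<lambda>i j.
     if i = 1 then basis3 j
     else if j = 1 then basis3 i
     else if i = 2 \<and> j = 2 then basis3 2
     else if i = 3 \<and> j = 3 then basis3 2 - basis3 1
     else 0)"

end

theory Submission
  imports Defs
begin

text \<open>Call \<open>x\<close> a generator of a law if \<open>x, x\<^sup>2, x\<^sup>3\<close> is a basis. A law with a generator is the law of
  \<open>(X)\<close> in \<open>\<real>[X] / (X (X\<^sup>3 - a X\<^sup>2 - b X - c))\<close>, and it is isomorphic to \<^const>\<open>mu1\<close> if the cubic has
  three distinct nonzero real roots, and to \<^const>\<open>mu2\<close> if it has a single, nonzero real root and a
  pair of nonreal ones. The coefficients \<open>a, b, c\<close> depend continuously on the law while \<open>x\<close> is fixed,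
  and both root patterns are stable, so \<^const>\<open>mu1\<close> and \<^const>\<open>mu2\<close> are rigid. Conversely, perturbing
  the roots of the cubic shows that a rigid law with a generator is one of these two.

  A law without generator has at most one nonzero idempotent: either all cubes vanish, or there is
  an idempotent \<open>e\<close> and a complement of \<open>\<real>e\<close> with zero multiplication on which \<open>e\<close> acts as \<open>0\<close> or
  \<open>1\<close>. In each case some deformation \<open>x \<odot> y + t f(x) f(y) w\<close> has one more idempotent, so the law is
  not rigid.\<close>

section \<open>Isomorphic laws, orbits and affine structures\<close>

lemma isomorphic_laws_refl: "isomorphic_laws \<mu> \<mu>"
  unfolding isomorphic_laws_def by (rule exI[of _ "\<lambda>x. x"]) (auto simp: linear_ident bij_def)

lemma isomorphic_laws_sym:
  assumes "isomorphic_laws \<mu> \<nu>"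
  shows "isomorphic_laws \<nu> \<mu>"
proof -
  obtain f where f: "linear f" "bij f" "\<And>x y. f (\<mu> x y) = \<nu> (f x) (f y)"
    using assms unfolding isomorphic_laws_def by auto
  have "inv f (\<nu> x y) = \<mu> (inv f x) (inv f y)" for x y
    using f(3)[of "inv f x" "inv f y"] f(2)
    by (simp add: bij_is_surj surj_f_inv_f) (metis bij_is_inj inv_f_f)
  moreover have "linear (inv f)"
    by (rule linearI; rule injD[OF bij_is_inj[OF f(2)]])
      (simp_all add: linear_add[OF f(1)] linear_scale[OF f(1)] surj_f_inv_f[OF bij_is_surj[OF f(2)]])
  ultimately show ?thesis
    unfolding isomorphic_laws_def using bij_imp_bij_inv[OF f(2)] by blast
qed

lemma isomorphic_laws_trans:
  assumes "isomorphic_laws \<mu> \<nu>" "isomorphic_laws \<nu> \<rho>"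
  shows "isomorphic_laws \<mu> \<rho>"
proof -
  obtain f g where "linear f" "bij f" "\<And>x y. f (\<mu> x y) = \<nu> (f x) (f y)"
    "linear g" "bij g" "\<And>x y. g (\<nu> x y) = \<rho> (g x) (g y)"
    using assms unfolding isomorphic_laws_def by auto
  then have "linear (g \<circ> f) \<and> bij (g \<circ> f) \<and> (\<forall>x y. (g \<circ> f) (\<mu> x y) = \<rho> ((g \<circ> f) x) ((g \<circ> f) y))"
    by (auto simp: linear_compose bij_comp)
  then show ?thesis
    unfolding isomorphic_laws_def by blast
qed

text \<open>\<open>\<nu> = law_action f \<mu>\<close> says precisely that \<open>f\<close> is an
  isomorphism from \<open>\<nu>\<close> onto \<open>\<mu>\<close>, so orbits are isomorphism
  classes.\<close>

lemma law_orbit_eq: "law_orbit \<mu> = {\<nu>. isomorphic_laws \<nu> \<mu>}"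
proof -
  have "\<nu> = law_action f \<mu> \<longleftrightarrow> (\<forall>x y. f (\<nu> x y) = \<mu> (f x) (f y))" if "bij f" for f \<nu>
    using that unfolding law_action_def fun_eq_iff
    by (metis bij_inv_eq_iff)
  then show ?thesis
    unfolding law_orbit_def isomorphic_laws_def by blast
qed

lemma rigid_law_cong:
  fixes \<mu> \<nu> :: "real^'n \<Rightarrow> real^'n \<Rightarrow> real^'n"
  assumes "rigid_law \<mu>" "isomorphic_laws \<mu> \<nu>" "\<nu> \<in> comm_assoc_laws"
  shows "rigid_law \<nu>"
proof -
  have "law_orbit \<mu> = law_orbit \<nu>"
    unfolding law_orbit_eq using assms(2) isomorphic_laws_sym isomorphic_laws_trans by blast
  then show ?thesis
    using assms unfolding rigid_law_def by simp
qed

lemma comm_assoc_lawsI: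
  assumes "\<And>x y z. \<mu> (x + y) z = \<mu> x z + \<mu> y z" "\<And>r x y. \<mu> (r *\<^sub>R x) y = r *\<^sub>R \<mu> x y"
    and comm: "\<And>x y. \<mu> x y = \<mu> y x" and "\<And>x y z. \<mu> (\<mu> x y) z = \<mu> x (\<mu> y z)"
  shows "\<mu> \<in> comm_assoc_laws"
proof -
  have lin: "linear (\<lambda>x. \<mu> x y)" for y
    using assms by (intro linearI) auto
  moreover have "linear (\<lambda>y. \<mu> x y)" for x
    unfolding comm[of x] by (rule lin)
  ultimately show ?thesis
    using assms unfolding comm_assoc_laws_def bilinear_def by auto
qed

lemma isomorphic_comm_assoc:
  assumes "isomorphic_laws \<nu> \<mu>" "\<mu> \<in> comm_assoc_laws"
  shows "\<nu> \<in> comm_assoc_laws"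
proof -
  obtain f where f: "linear f" "bij f" "\<And>x y. f (\<nu> x y) = \<mu> (f x) (f y)"
    using assms(1) unfolding isomorphic_laws_def by auto
  have \<mu>: "bilinear \<mu>" "\<And>x y. \<mu> x y = \<mu> y x" "\<And>x y z. \<mu> (\<mu> x y) z = \<mu> x (\<mu> y z)"
    using assms(2) unfolding comm_assoc_laws_def by auto
  have eq: "u = v" if "f u = f v" for u v
    using that f(2) by (simp add: bij_is_inj inj_eq)
  show ?thesis
    by ((rule comm_assoc_lawsI; rule eq),
        simp_all add: f(3) linear_add[OF f(1)] linear_scale[OF f(1)] bilinear_ladd[OF \<mu>(1)]
          bilinear_lmul[OF \<mu>(1)] \<mu>(3)) (rule \<mu>(2))
qed

section \<open>Structure constants and continuous families of laws\<close>

lemma law_of_structure_constants: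
  assumes "bilinear \<nu>"
  shows "law_of_table (\<lambda>i j. structure_constants \<nu> $ i $ j) x y = \<nu> x y"
proof -
  have t: "structure_constants \<nu> $ i $ j = \<nu> (axis i 1) (axis j 1)" for i j
    by (simp add: structure_constants_def vec_eq_iff)
  have "\<nu> x y = \<nu> (\<Sum>i\<in>UNIV. x $ i *\<^sub>R axis i 1) (\<Sum>j\<in>UNIV. y $ j *\<^sub>R axis j 1)"
    using basis_expansion[of x] basis_expansion[of y] by (simp add: scalar_mult_eq_scaleR)
  also have "\<dots> = (\<Sum>(i,j)\<in>UNIV\<times>UNIV. \<nu> (x $ i *\<^sub>R axis i 1) (y $ j *\<^sub>R axis j 1))"
    by (rule bilinear_sum[OF assms])
  also have "\<dots> = law_of_table (\<lambda>i j. structure_constants \<nu> $ i $ j) x y"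
    unfolding law_of_table_def t using assms
    by (simp add: sum.cartesian_product bilinear_lmul bilinear_rmul)
  finally show ?thesis by simp
qed

text \<open>A curve of laws that is continuous at a rigid law stays in its open orbit near 0.
  Pointwise continuity is enough, as only finitely many structure constants matter. All later
  non-rigidity proofs rest on this.\<close>

lemma rigid_law_eventually_isomorphic:
  fixes \<nu> :: "real \<Rightarrow> real^'n \<Rightarrow> real^'n \<Rightarrow> real^'n"
  assumes "rigid_law (\<nu> 0)" "\<And>t. \<nu> t \<in> comm_assoc_laws"
    and "\<And>x y. isCont (\<lambda>t. \<nu> t x y) 0"
  shows "\<forall>\<^sub>F t in at 0. isomorphic_laws (\<nu> t) (\<nu> 0)"
proof -
  obtain U where U: "open U" "law_orbit (\<nu> 0) = structure_constants -` U \<inter> comm_assoc_laws"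
    using assms(1) unfolding rigid_law_def law_topology_def openin_pullback_topology by auto
  have "((\<lambda>t. structure_constants (\<nu> t)) \<longlongrightarrow> structure_constants (\<nu> 0)) (at 0)"
    unfolding structure_constants_def
    by (intro tendsto_vec_lambda tendsto_vec_nth) (use assms(3) in \<open>simp add: isCont_def\<close>)
  moreover have "structure_constants (\<nu> 0) \<in> U"
    using U(2) isomorphic_laws_refl[of "\<nu> 0"] unfolding law_orbit_eq by blast
  ultimately have "\<forall>\<^sub>F t in at 0. structure_constants (\<nu> t) \<in> U"
    using U(1) topological_tendstoD by blast
  then show ?thesis
    by eventually_elim (use U(2) assms(2) in \<open>auto simp: law_orbit_eq\<close>)
qed

section \<open>The affine structure attached to a law\<close>

lemma translation_part_affine_structure_of_law: "translation_part (affine_structure_of_law \<mu> X) = X"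
  by (simp add: translation_part_def affine_structure_of_law_def affine_matrix_def vec_eq_iff)

lemma linear_part_affine_structure_of_law:
  "linear_part (affine_structure_of_law \<mu> X) = matrix (\<mu> X)"
  by (simp add: linear_part_def affine_structure_of_law_def affine_matrix_def vec_eq_iff)

lemma affine_product_affine_structure_of_law:
  assumes "bilinear \<mu>"
  shows "affine_product (affine_structure_of_law \<mu>) = \<mu>"
proof -
  have "linear (\<mu> X)" for X
    using assms by (simp add: bilinear_def)
  then show ?thesis
    unfolding affine_product_def fun_eq_iff translation_part_affine_structure_of_law
      linear_part_affine_structure_of_law
    by (simp add: matrix_works linear_matrix_vector_mul_eq inv_id[unfolded id_def])
qed

lemma affine_matrix_mult:
  "affine_matrix A b ** affine_matrix A' b' = affine_matrix (A ** A') (A *v b')"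
proof -
  have s: "sum g UNIV = g None + (\<Sum>k\<in>UNIV. g (Some k))" for g :: "'a option \<Rightarrow> real"
    unfolding UNIV_option_conv by (simp add: sum.reindex)
  show ?thesis
    by (simp add: vec_eq_iff matrix_matrix_mult_def affine_matrix_def matrix_vector_mult_def s
        split: option.split)
qed

text \<open>The commutator has linear part \<open>L_X L_Y - L_Y L_X\<close>, which vanishes by
  associativity and commutativity, and translation part \<open>L_X Y - L_Y X\<close>, which vanishes
  by commutativity.\<close>

lemma affine_structure_of_comm_assoc_law:
  fixes \<mu> :: "real^'n \<Rightarrow> real^'n \<Rightarrow> real^'n"
  assumes "\<mu> \<in> comm_assoc_laws"
  shows "affine_structure abelian_bracket (affine_structure_of_law \<mu>)"
proof -
  have \<mu>: "bilinear \<mu>" "\<And>x y. \<mu> x y = \<mu> y x" "\<And>x y z. \<mu> (\<mu> x y) z = \<mu> x (\<mu> y z)"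
    using assms unfolding comm_assoc_laws_def by auto
  have lin: "linear (\<mu> X)" for X
    using \<mu>(1) by (simp add: bilinear_def)
  have "\<mu> X (\<mu> Y Z) = \<mu> Y (\<mu> X Z)" for X Y Z
    using \<mu>(2,3) by metis
  then have "matrix (\<mu> X) ** matrix (\<mu> Y) = matrix (\<mu> Y) ** matrix (\<mu> X)" for X Y
    by (simp add: lin matrix_compose[symmetric] comp_def)
  moreover have "matrix (\<mu> X) *v Y = matrix (\<mu> Y) *v X" for X Y
    by (simp add: lin matrix_works \<mu>(2))
  moreover have "linear (affine_structure_of_law \<mu>)"
    by (rule linearI)
      (auto simp: affine_structure_of_law_def affine_matrix_def matrix_def vec_eq_iff
        bilinear_ladd[OF \<mu>(1)] bilinear_lmul[OF \<mu>(1)] split: option.split)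
  ultimately show ?thesis
    unfolding affine_structure_def translation_part_affine_structure_of_law
    using linear_0[of "affine_structure_of_law \<mu>"]
    by (auto simp: aff_algebra_def affine_structure_of_law_def matrix_commutator_def
        affine_matrix_mult abelian_bracket_def linear_ident bij_def)
qed

lemma rigid_affine_structure_of_law:
  assumes "rigid_law \<mu>"
  shows "rigid_affine_structure (affine_structure_of_law \<mu>)"
proof -
  have "\<mu> \<in> comm_assoc_laws"
    using assms by (simp add: rigid_law_def)
  then have "affine_structure abelian_bracket (affine_structure_of_law \<mu>)" "bilinear \<mu>"
    by (rule affine_structure_of_comm_assoc_law) (use \<open>\<mu> \<in> _\<close> in \<open>simp add: comm_assoc_laws_def\<close>)
  then show ?thesis
    using assms by (simp add: rigid_affine_structure_def affine_product_affine_structure_of_law)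
qed

section \<open>Semisimplicity\<close>

text \<open>A power of \<open>x\<close> lies in the vanishing power of the ideal, so a power of
  \<open>\<phi> x\<close> is 0. Only multiplicativity enters, which lets \<open>\<phi>\<close> be a
  quadratic norm as well as a character.\<close>

lemma mult_functional_zero_on_nilpotent_ideal:
  fixes \<phi> :: "'a::real_vector \<Rightarrow> real"
  assumes mult: "\<And>x y. \<phi> (\<mu> x y) = \<phi> x * \<phi> y" and zero: "\<phi> 0 = 0"
    and nil: "ideal_power \<mu> I k = {0}" and "x \<in> I"
  shows "\<phi> x = 0"
proof -
  have "\<exists>y\<in>ideal_power \<mu> I k. \<phi> y = \<phi> x ^ Suc k" for k
  proof (induction k)
    case (Suc k)
    then obtain y where "y \<in> ideal_power \<mu> I k" "\<phi> y = \<phi> x ^ Suc k"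
      by blast
    then show ?case
      using mult[of x y] \<open>x \<in> I\<close> by (intro bexI[of _ "\<mu> x y"]) (auto intro!: span_base)
  qed (use \<open>x \<in> I\<close> in auto)
  then show ?thesis
    using nil zero by (metis power_eq_0_iff singletonD)
qed

section \<open>The laws \<open>mu1\<close> and \<open>mu2\<close> in coordinates\<close>

lemma mu1_nth:
  "mu1 x y $ 1 = x $ 1 * y $ 1"
  "mu1 x y $ 2 = x $ 1 * y $ 2 + x $ 2 * y $ 1 + x $ 2 * y $ 2"
  "mu1 x y $ 3 = x $ 1 * y $ 3 + x $ 3 * y $ 1 + x $ 3 * y $ 3"
  by (simp_all add: mu1_def law_of_table_def sum_3 axis_def)

lemma mu2_nth:
  "mu2 x y $ 1 = x $ 1 * y $ 1 - x $ 3 * y $ 3"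
  "mu2 x y $ 2 = x $ 1 * y $ 2 + x $ 2 * y $ 1 + x $ 2 * y $ 2 + x $ 3 * y $ 3"
  "mu2 x y $ 3 = x $ 1 * y $ 3 + x $ 3 * y $ 1"
  by (simp_all add: mu2_def law_of_table_def sum_3 axis_def)

lemma mu1_comm_assoc: "mu1 \<in> comm_assoc_laws"
  by (rule comm_assoc_lawsI) (simp_all add: vec_eq_iff forall_3 mu1_nth algebra_simps)

lemma mu2_comm_assoc: "mu2 \<in> comm_assoc_laws"
  by (rule comm_assoc_lawsI) (simp_all add: vec_eq_iff forall_3 mu2_nth algebra_simps)

text \<open>\<open>mu1\<close> is the product of three copies of \<real>; the three projections are
  \<open>x $ 1\<close>, \<open>x $ 1 + x $ 2\<close> and \<open>x $ 1 + x $ 3\<close>.\<close>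

lemma semisimple_mu1: "semisimple_law mu1"
  unfolding semisimple_law_def
proof (intro allI impI, elim conjE exE)
  fix I k assume I: "law_ideal mu1 I" "ideal_power mu1 I k = {0}"
  have "x = 0" if "x \<in> I" for x
  proof -
    have "x $ 1 = 0"
      by (rule mult_functional_zero_on_nilpotent_ideal[OF _ _ I(2) that]) (auto simp: mu1_nth)
    moreover have "x $ 1 + x $ 2 = 0"
      by (rule mult_functional_zero_on_nilpotent_ideal[OF _ _ I(2) that])
        (auto simp: mu1_nth algebra_simps)
    moreover have "x $ 1 + x $ 3 = 0"
      by (rule mult_functional_zero_on_nilpotent_ideal[OF _ _ I(2) that])
        (auto simp: mu1_nth algebra_simps)
    ultimately show ?thesis
      by (simp add: vec_eq_iff forall_3)
  qed
  then show "I = {0}"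
    using I(1) subspace_0 unfolding law_ideal_def by blast
qed

text \<open>\<open>mu2\<close> is \<real> \<times> \<complex>. The projection to \<real> and the
  squared modulus of the projection to \<complex> are multiplicative and vanish together only at
  0.\<close>

lemma semisimple_mu2: "semisimple_law mu2"
  unfolding semisimple_law_def
proof (intro allI impI, elim conjE exE)
  fix I k assume I: "law_ideal mu2 I" "ideal_power mu2 I k = {0}"
  have "x = 0" if "x \<in> I" for x
  proof -
    have "x $ 1 + x $ 2 = 0"
      by (rule mult_functional_zero_on_nilpotent_ideal[OF _ _ I(2) that])
        (auto simp: mu2_nth algebra_simps)
    \<comment> \<open>\<open>x $ 1 + \<i> x $ 3\<close> is the projection to the factor \<open>\<complex>\<close>.\<close>
    moreover have "(x $ 1)\<^sup>2 + (x $ 3)\<^sup>2 = 0"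
      by (rule mult_functional_zero_on_nilpotent_ideal[OF _ _ I(2) that])
        (auto simp: mu2_nth algebra_simps power2_eq_square)
    ultimately show ?thesis
      by (auto simp: vec_eq_iff forall_3 sum_power2_eq_zero_iff)
  qed
  then show "I = {0}"
    using I(1) subspace_0 unfolding law_ideal_def by blast
qed

text \<open>The imaginary unit of the factor \<complex> of \<open>mu2\<close> is nonzero with fourth
  power equal to minus its square. In a product of copies of \<real> only 0 has this
  property.\<close>

lemma not_isomorphic_mu1_mu2: "\<not> isomorphic_laws mu1 mu2"
proof
  assume "isomorphic_laws mu1 mu2"
  then obtain f where f: "linear f" "bij f" "\<And>x y. f (mu2 x y) = mu1 (f x) (f y)"
    using isomorphic_laws_sym unfolding isomorphic_laws_def by blast
  define i :: "real^3" where "i = axis 3 1"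
  have "mu2 (mu2 i i) (mu2 i i) = - mu2 i i"
    by (simp add: i_def vec_eq_iff forall_3 mu2_nth axis_def)
  then have sq: "mu1 (mu1 (f i) (f i)) (mu1 (f i) (f i)) = - mu1 (f i) (f i)"
    by (metis f(1,3) linear_neg)
  have no_root: "s = 0" if "(s * s) * (s * s) = - (s * s)" for s :: real
  proof -
    have "s * s * (s * s + 1) = 0"
      using that by (simp add: algebra_simps)
    then show ?thesis
      by (smt (verit) mult_eq_0_iff zero_le_square)
  qed
  have "f i $ 1 = 0"
    using arg_cong[OF sq, of "\<lambda>v. v $ 1"] by (intro no_root) (simp add: mu1_nth)
  \<comment> \<open>Once the first coordinate vanishes, the other two coordinates multiply like
    characters.\<close>
  moreover have "f i $ 2 = 0" "f i $ 3 = 0"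
    using arg_cong[OF sq, of "\<lambda>v. v $ 2"] arg_cong[OF sq, of "\<lambda>v. v $ 3"] calculation
    by (auto simp: mu1_nth intro!: no_root)
  ultimately have "f i = f 0"
    using f(1) by (simp add: vec_eq_iff forall_3 linear_0)
  then have "i = 0"
    using f(2) by (simp add: bij_is_inj inj_eq)
  then show False
    by (simp add: i_def axis_eq_0_iff)
qed

section \<open>Laws generated by one element\<close>

text \<open>Nonvanishing tests for a basis, and Cramer's rule yields coordinates that depend
  continuously on the vectors.\<close>

definition triple :: "real^3 \<Rightarrow> real^3 \<Rightarrow> real^3 \<Rightarrow> real" where
  "triple x y z = det (vector [x, y, z])"

lemma triple_expand:
  "triple x y z = x$1 * (y$2 * z$3 - y$3 * z$2) - x$2 * (y$1 * z$3 - y$3 * z$1)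
     + x$3 * (y$1 * z$2 - y$2 * z$1)"
  by (simp add: triple_def det_3 algebra_simps)

lemma triple_same [simp]: "triple x x y = 0" "triple x y x = 0" "triple y x x = 0"
  by (simp_all add: triple_expand algebra_simps)

lemma triple_cramer:
  "triple p q r *\<^sub>R x = triple x q r *\<^sub>R p + triple p x r *\<^sub>R q + triple p q x *\<^sub>R r"
  by (simp add: triple_expand vec_eq_iff forall_3 algebra_simps)

lemma triple_basis_expansion:
  assumes "triple p q r \<noteq> 0"
  obtains a b c where "x = a *\<^sub>R p + b *\<^sub>R q + c *\<^sub>R r"
proof -
  have "x = (1 / triple p q r) *\<^sub>R (triple p q r *\<^sub>R x)"
    using assms by simp
  also have "\<dots> = (triple x q r / triple p q r) *\<^sub>R p + (triple p x r / triple p q r) *\<^sub>R q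
      + (triple p q x / triple p q r) *\<^sub>R r"
    unfolding triple_cramer[of p q r x] by (simp add: scaleR_right_distrib)
  finally show ?thesis
    using that by blast
qed

lemma triple_independent:
  assumes "triple p q r \<noteq> 0" "a *\<^sub>R p + b *\<^sub>R q + c *\<^sub>R r = 0"
  shows "a = 0" "b = 0" "c = 0"
proof -
  have "a * triple p q r = triple (a *\<^sub>R p + b *\<^sub>R q + c *\<^sub>R r) q r"
    "b * triple p q r = triple p (a *\<^sub>R p + b *\<^sub>R q + c *\<^sub>R r) r"
    "c * triple p q r = triple p q (a *\<^sub>R p + b *\<^sub>R q + c *\<^sub>R r)"
    by (simp_all add: triple_expand algebra_simps)
  then show "a = 0" "b = 0" "c = 0"
    using assms by (simp_all add: triple_expand)
qed

lemma triple_basis_bij: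
  assumes "triple p q r \<noteq> 0"
  shows "linear (\<lambda>x::real^3. x$1 *\<^sub>R p + x$2 *\<^sub>R q + x$3 *\<^sub>R r)"
    and "bij (\<lambda>x::real^3. x$1 *\<^sub>R p + x$2 *\<^sub>R q + x$3 *\<^sub>R r)"
proof -
  show lin: "linear (\<lambda>x::real^3. x$1 *\<^sub>R p + x$2 *\<^sub>R q + x$3 *\<^sub>R r)"
    by (rule linearI) (simp_all add: algebra_simps)
  have "inj (\<lambda>x::real^3. x$1 *\<^sub>R p + x$2 *\<^sub>R q + x$3 *\<^sub>R r)"
    unfolding linear_injective_0[OF lin]
  proof (intro allI impI)
    fix x :: "real^3" assume "x$1 *\<^sub>R p + x$2 *\<^sub>R q + x$3 *\<^sub>R r = 0"
    from triple_independent[OF assms this] show "x = 0"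
      by (simp add: vec_eq_iff forall_3)
  qed
  then show "bij (\<lambda>x::real^3. x$1 *\<^sub>R p + x$2 *\<^sub>R q + x$3 *\<^sub>R r)"
    using lin linear_injective_imp_surjective by (auto simp: bij_def)
qed

text \<open>The law of the maximal ideal \<open>(X)\<close> in \<open>\<real>[X] / (X (X\<^sup>3 - a X\<^sup>2 - b X - c))\<close>, in the basis
  \<open>X, X\<^sup>2, X\<^sup>3\<close>; \<open>u\<close>, \<open>v\<close>, \<open>w\<close> are the coefficients of \<open>X\<^sup>4, X\<^sup>5, X\<^sup>6\<close> in the product of polynomials.\<close>

definition cubic_law :: "real \<Rightarrow> real \<Rightarrow> real \<Rightarrow> real^3 \<Rightarrow> real^3 \<Rightarrow> real^3" where
  "cubic_law a b c x y =
    (let u = x$1 * y$3 + x$2 * y$2 + x$3 * y$1;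
         v = x$2 * y$3 + x$3 * y$2;
         w = x$3 * y$3
     in vector [u * c + v * (a * c) + w * (a * (a * c) + b * c),
        x$1 * y$1 + u * b + v * (a * b + c) + w * (a * (a * b + c) + b * b),
        x$1 * y$2 + x$2 * y$1 + u * a + v * (a * a + b) + w * (a * (a * a + b) + a * b + c)])"

lemma cubic_law_comm_assoc: "cubic_law a b c \<in> comm_assoc_laws"
proof (rule comm_assoc_lawsI)
  show "cubic_law a b c (cubic_law a b c x y) z = cubic_law a b c x (cubic_law a b c y z)" for x y z
    unfolding vec_eq_iff forall_3 cubic_law_def Let_def vector_3 by (intro conjI; algebra)
qed (simp_all add: vec_eq_iff forall_3 cubic_law_def Let_def algebra_simps)

lemma tendsto_cubic_law:
  assumes "(A \<longlongrightarrow> a) F" "(B \<longlongrightarrow> b) F" "(C \<longlongrightarrow> c) F"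
  shows "((\<lambda>t. cubic_law (A t) (B t) (C t) x y) \<longlongrightarrow> cubic_law a b c x y) F"
proof (rule vec_tendstoI)
  fix i
  show "((\<lambda>t. cubic_law (A t) (B t) (C t) x y $ i) \<longlongrightarrow> cubic_law a b c x y $ i) F"
    using exhaust_3[of i] assms
    by (elim disjE; simp add: cubic_law_def Let_def; intro tendsto_intros)
qed

text \<open>\<open>P\<close> evaluates the polynomial with coefficients \<open>x\<close> at a root
  \<open>z\<close>. Reducing \<open>z^4\<close>, \<open>z^5\<close>, \<open>z^6\<close> by the cubic
  equation reproduces the coefficients in \<open>cubic_law\<close>. The algebra is general so that
  real and complex roots are covered at once.\<close>

lemma cubic_law_eval:
  fixes z :: "'a::{real_algebra_1, comm_ring_1}"
  assumes z: "z ^ 3 = of_real a * z\<^sup>2 + of_real b * z + of_real c"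
  defines "P \<equiv> \<lambda>x::real^3. of_real (x$1) * z + of_real (x$2) * z\<^sup>2 + of_real (x$3) * z ^ 3"
  shows "P (cubic_law a b c x y) = P x * P y"
proof -
  define A B C where "A = (of_real a :: 'a)" "B = (of_real b :: 'a)" "C = (of_real c :: 'a)"
  have z3: "z * (z * z) = A * (z * z) + B * z + C"
    using z by (simp add: A_B_C_def power2_eq_square power3_eq_cube algebra_simps)
  have z4: "z ^ 4 = A * z ^ 3 + B * z\<^sup>2 + C * z"
    using arg_cong[OF z3, of "\<lambda>v. z * v"] by (simp add: eval_nat_numeral algebra_simps)
  have z5: "z ^ 5 = (A * A + B) * z ^ 3 + (A * B + C) * z\<^sup>2 + A * C * z"
    using arg_cong[OF z4, of "\<lambda>v. z * v"] z4 by (simp add: eval_nat_numeral algebra_simps)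
  have z6: "z ^ 6 = (A * (A * A + B) + A * B + C) * z ^ 3 + (A * (A * B + C) + B * B) * z\<^sup>2
      + (A * (A * C) + B * C) * z"
    using arg_cong[OF z5, of "\<lambda>v. z * v"] z4 by (simp add: eval_nat_numeral algebra_simps)
  define X Y where XY: "X = (\<lambda>k. of_real (x $ k) :: 'a)" "Y = (\<lambda>k. of_real (y $ k) :: 'a)"
  have "P x * P y = X 1 * Y 1 * z\<^sup>2 + (X 1 * Y 2 + X 2 * Y 1) * z ^ 3
      + (X 1 * Y 3 + X 2 * Y 2 + X 3 * Y 1) * z ^ 4 + (X 2 * Y 3 + X 3 * Y 2) * z ^ 5 + X 3 * Y 3 * z ^ 6"
    unfolding P_def XY by (simp add: eval_nat_numeral algebra_simps)
  then show ?thesis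
    unfolding z4 z5 z6 unfolding P_def XY A_B_C_def
    by (simp add: cubic_law_def Let_def algebra_simps)
qed

text \<open>Evaluation at the three roots gives three characters, which are jointly injective by a
  Vandermonde argument.\<close>

lemma cubic_law_iso_mu1:
  assumes "r \<noteq> 0" "s \<noteq> 0" "t \<noteq> 0" "r \<noteq> s" "r \<noteq> t" "s \<noteq> t"
    and root: "r ^ 3 = a * r\<^sup>2 + b * r + c" "s ^ 3 = a * s\<^sup>2 + b * s + c" "t ^ 3 = a * t\<^sup>2 + b * t + c"
  shows "isomorphic_laws (cubic_law a b c) mu1"
proof -
  define P where "P = (\<lambda>z (x::real^3). x$1 * z + x$2 * z\<^sup>2 + x$3 * z ^ 3)"
  have mult: "P z (cubic_law a b c x y) = P z x * P z y" if "z ^ 3 = a * z\<^sup>2 + b * z + c" for z x y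
    using cubic_law_eval[of z a b c x y] that by (simp add: P_def)
  \<comment> \<open>The differences make the projections \<open>x $ 1\<close>,
    \<open>x $ 1 + x $ 2\<close>, \<open>x $ 1 + x $ 3\<close> of \<open>mu1\<close> pull back to
    evaluation at \<open>r\<close>, \<open>s\<close>, \<open>t\<close>.\<close>
  define f :: "real^3 \<Rightarrow> real^3" where "f x = vector [P r x, P s x - P r x, P t x - P r x]" for x
  have lin: "linear f"
    by (rule linearI) (simp_all add: f_def P_def vec_eq_iff forall_3 algebra_simps)
  have "x = 0" if "f x = 0" for x
  proof -
    have z: "x$1 + x$2 * z + x$3 * (z * z) = 0" if "P z x = 0" "z \<noteq> 0" for z
    proof -
      have "z * (x$1 + x$2 * z + x$3 * (z * z)) = 0"
        using that(1) by (simp add: P_def eval_nat_numeral algebra_simps)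
      then show ?thesis using that(2) by simp
    qed
    have P: "P r x = 0" "P s x = 0" "P t x = 0"
      using that by (auto simp: f_def vec_eq_iff forall_3)
    \<comment> \<open>Divided differences of the quadratic \<open>x$1 + x$2 X + x$3 X^2\<close>,
      which vanishes at all three roots.\<close>
    have "(r - s) * (x$2 + x$3 * (r + s)) = 0" "(r - t) * (x$2 + x$3 * (r + t)) = 0"
      using z[OF P(1)] z[OF P(2)] z[OF P(3)] assms(1-3) by (simp_all add: algebra_simps)
    then have e: "x$2 + x$3 * (r + s) = 0" "x$2 + x$3 * (r + t) = 0"
      using assms(4,5) by simp_all
    have "x$3 * (s - t) = (x$2 + x$3 * (r + s)) - (x$2 + x$3 * (r + t))"
      by (simp add: algebra_simps)
    then have "x$3 * (s - t) = 0"
      using e by simp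
    then have "x$3 = 0" "x$2 = 0" "x$1 = 0"
      using assms(6) e z[OF P(1) assms(1)] by auto
    then show ?thesis
      by (simp add: vec_eq_iff forall_3)
  qed
  then have "inj f"
    unfolding linear_injective_0[OF lin] by blast
  then have "bij f"
    using lin linear_injective_imp_surjective by (auto simp: bij_def)
  moreover have "f (cubic_law a b c x y) = mu1 (f x) (f y)" for x y
    using root by (simp add: vec_eq_iff forall_3 f_def mu1_nth mult algebra_simps)
  ultimately show ?thesis
    using lin unfolding isomorphic_laws_def by blast
qed

lemma cubic_law_iso_mu2:
  fixes z :: complex
  assumes "r \<noteq> 0" "Im z \<noteq> 0"
    and root: "r ^ 3 = a * r\<^sup>2 + b * r + c"
      "z ^ 3 = of_real a * z\<^sup>2 + of_real b * z + of_real c"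
  shows "isomorphic_laws (cubic_law a b c) mu2"
proof -
  define P where "P = (\<lambda>x::real^3. x$1 * r + x$2 * r\<^sup>2 + x$3 * r ^ 3)"
  define Q where
    "Q = (\<lambda>x::real^3. of_real (x$1) * z + of_real (x$2) * z\<^sup>2 + of_real (x$3) * z ^ 3)"
  have mult: "P (cubic_law a b c x y) = P x * P y" "Q (cubic_law a b c x y) = Q x * Q y" for x y
    using cubic_law_eval[of r a b c x y] cubic_law_eval[of z a b c x y] root
    by (simp_all add: P_def Q_def)
  \<comment> \<open>Chosen so that the projections \<open>x $ 1 + x $ 2\<close> and
    \<open>x $ 1 + \<i> x $ 3\<close> of \<open>mu2\<close> pull back to \<open>P\<close> and
    \<open>Q\<close>.\<close>
  define f :: "real^3 \<Rightarrow> real^3" where "f x = vector [Re (Q x), P x - Re (Q x), Im (Q x)]" for x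
  have lin: "linear f"
    by (rule linearI) (simp_all add: f_def P_def Q_def vec_eq_iff forall_3 algebra_simps)
  have "x = 0" if "f x = 0" for x
  proof -
    have PQ: "P x = 0" "Q x = 0"
      using that by (auto simp: f_def vec_eq_iff forall_3 complex_eq_iff)
    have "z * (of_real (x$1) + of_real (x$2) * z + of_real (x$3) * (z * z)) = 0"
      "r * (x$1 + x$2 * r + x$3 * (r * r)) = 0"
      using PQ by (simp_all add: P_def Q_def eval_nat_numeral algebra_simps)
    then have q: "of_real (x$1) + of_real (x$2) * z + of_real (x$3) * (z * z) = 0"
      and p: "x$1 + x$2 * r + x$3 * (r * r) = 0"
      using assms(1,2) by auto
    \<comment> \<open>A real quadratic with the nonreal zero \<open>z\<close> is \<open>x$3\<close>
      times \<open>(X - Re z)^2 + (Im z)^2\<close>, and that factor is nonzero at the real point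
      \<open>r\<close>.\<close>
    have "Im z * (x$2 + 2 * x$3 * Re z) = 0"
      using arg_cong[OF q, of Im] by (simp add: algebra_simps)
    then have x2: "x$2 = - 2 * x$3 * Re z"
      using assms(2) by simp
    then have x1: "x$1 = x$3 * (Re z * Re z + Im z * Im z)"
      using arg_cong[OF q, of Re] by (simp add: algebra_simps)
    have "x$3 * ((r - Re z)\<^sup>2 + (Im z)\<^sup>2) = 0"
      using p unfolding x1 x2 by (simp add: power2_eq_square algebra_simps)
    moreover have "(r - Re z)\<^sup>2 + (Im z)\<^sup>2 \<noteq> 0"
      using assms(2) by (simp add: sum_power2_eq_zero_iff)
    ultimately have "x$3 = 0"
      by (metis mult_eq_0_iff)
    then show ?thesis
      using x1 x2 by (simp add: vec_eq_iff forall_3)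
  qed
  then have "inj f"
    unfolding linear_injective_0[OF lin] by blast
  then have "bij f"
    using lin linear_injective_imp_surjective by (auto simp: bij_def)
  moreover have "f (cubic_law a b c x y) = mu2 (f x) (f y)" for x y
    by (simp add: vec_eq_iff forall_3 f_def mu2_nth mult algebra_simps)
  ultimately show ?thesis
    using lin unfolding isomorphic_laws_def by blast
qed

text \<open>The cubic is \<open>(X - r) (X^2 - p X - q)\<close>; the hypotheses say that its roots
  are nonzero and distinct, and the sign of the discriminant of the quadratic factor separates the
  two root patterns.\<close>

lemma separable_cubic_law:
  assumes "r \<noteq> 0" "q \<noteq> 0" "p\<^sup>2 + 4 * q \<noteq> 0" "r\<^sup>2 - p * r - q \<noteq> 0"
    and abc: "a = r + p" "b = q - r * p" "c = - (r * q)"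
  shows "0 < p\<^sup>2 + 4 * q \<Longrightarrow> isomorphic_laws (cubic_law a b c) mu1"
    and "p\<^sup>2 + 4 * q < 0 \<Longrightarrow> isomorphic_laws (cubic_law a b c) mu2"
proof -
  have r: "r ^ 3 = a * r\<^sup>2 + b * r + c"
    unfolding abc by (simp add: eval_nat_numeral algebra_simps)
  {
    assume "0 < p\<^sup>2 + 4 * q"
    define d where "d = sqrt (p\<^sup>2 + 4 * q)"
    have d: "d * d = p * p + 4 * q" "d > 0"
      using \<open>0 < p\<^sup>2 + 4 * q\<close> by (simp_all add: d_def power2_eq_square)
    define s t where "s = (p + d) / 2" "t = (p - d) / 2"
    have st: "s\<^sup>2 = p * s + q" "t\<^sup>2 = p * t + q"
      using d(1) unfolding s_t_def by (simp_all add: power2_eq_square field_simps)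
    have root: "u ^ 3 = a * u\<^sup>2 + b * u + c" if "u\<^sup>2 = p * u + q" for u
    proof -
      have "(u - r) * (u\<^sup>2 - p * u - q) = 0"
        using that by simp
      then show ?thesis
        unfolding abc by (simp add: eval_nat_numeral algebra_simps)
    qed
    have "s \<noteq> t"
      using d(2) by (simp add: s_t_def field_simps)
    moreover have "s \<noteq> 0" "t \<noteq> 0" "r \<noteq> s" "r \<noteq> t"
      using st assms(2,4) by auto
    ultimately show "isomorphic_laws (cubic_law a b c) mu1"
      using cubic_law_iso_mu1 assms(1) r root st by blast
  next
    assume "p\<^sup>2 + 4 * q < 0"
    define d where "d = sqrt (- (p\<^sup>2 + 4 * q))"
    have d: "d * d = - (p * p + 4 * q)" "d > 0"
      using \<open>p\<^sup>2 + 4 * q < 0\<close> by (simp_all add: d_def power2_eq_square)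
    define z where "z = Complex (p / 2) (d / 2)"
    have "z\<^sup>2 = of_real p * z + of_real q"
      using d(1) by (simp add: z_def complex_eq_iff power2_eq_square field_simps)
    then have "(z - of_real r) * (z\<^sup>2 - of_real p * z - of_real q) = 0"
      by simp
    then have "z ^ 3 = of_real a * z\<^sup>2 + of_real b * z + of_real c"
      unfolding abc by (simp add: eval_nat_numeral algebra_simps)
    moreover have "Im z \<noteq> 0"
      using d(2) by (simp add: z_def)
    ultimately show "isomorphic_laws (cubic_law a b c) mu2"
      using cubic_law_iso_mu2 assms(1) r by blast
  }
qed

section \<open>Real cubics and the perturbation of their roots\<close>

lemma real_cubic_root:
  obtains r :: real where "r ^ 3 = a * r\<^sup>2 + b * r + c"
proof -
  define g where "g = (\<lambda>x. x ^ 3 - a * x\<^sup>2 - b * x - c)"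
  \<comment> \<open>With this \<open>M \<ge> 1\<close> the lower terms at \<open>M\<close> and
    \<open>- M\<close> are at most \<open>(M - 1) M^2\<close> in absolute value, so
    \<open>M^3\<close> decides the sign.\<close>
  define M where "M = 1 + \<bar>a\<bar> + \<bar>b\<bar> + \<bar>c\<bar>"
  have M: "M \<ge> 1" "\<bar>a\<bar> + \<bar>b\<bar> + \<bar>c\<bar> = M - 1"
    by (simp_all add: M_def)
  have "M \<le> M\<^sup>2" "1 \<le> M\<^sup>2"
    using M(1) by (simp_all add: self_le_power)
  then have "\<bar>b\<bar> * M \<le> \<bar>b\<bar> * M\<^sup>2" "\<bar>c\<bar> * 1 \<le> \<bar>c\<bar> * M\<^sup>2"
    by (intro mult_left_mono; simp)+
  moreover have "\<bar>a * M\<^sup>2 + b * M + c\<bar> \<le> \<bar>a\<bar> * M\<^sup>2 + \<bar>b\<bar> * M + \<bar>c\<bar>"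
    "\<bar>a * M\<^sup>2 - b * M + c\<bar> \<le> \<bar>a\<bar> * M\<^sup>2 + \<bar>b\<bar> * M + \<bar>c\<bar>"
    using M(1) abs_mult[of a "M\<^sup>2"] abs_mult[of b M] by (auto simp: abs_le_iff)
  moreover have "\<bar>a\<bar> * M\<^sup>2 + \<bar>b\<bar> * M\<^sup>2 + \<bar>c\<bar> * M\<^sup>2 = M ^ 3 - M\<^sup>2"
    unfolding distrib_right[symmetric] M(2) by (simp add: eval_nat_numeral algebra_simps)
  moreover have "M\<^sup>2 \<ge> 0"
    by simp
  ultimately have "a * M\<^sup>2 + b * M + c \<le> M ^ 3" "- (M ^ 3) \<le> a * M\<^sup>2 - b * M + c"
    by linarith+
  then have "g (- M) \<le> 0" "0 \<le> g M"
    by (simp_all add: g_def)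
  moreover have "- M \<le> M"
    using M(1) by simp
  moreover have "\<forall>x. - M \<le> x \<and> x \<le> M \<longrightarrow> isCont g x"
    unfolding g_def by (auto intro!: continuous_intros)
  ultimately obtain r where "g r = 0"
    using IVT[of g "- M" 0 M] by auto
  then have "r ^ 3 = a * r\<^sup>2 + b * r + c"
    unfolding g_def by linarith
  then show ?thesis
    by (rule that)
qed

lemma eventually_linear_nonzero: "\<forall>\<^sub>F t in at (0::real). m + k * t \<noteq> 0" if "k \<noteq> 0"
proof -
  have "\<forall>\<^sub>F t in at 0. t \<noteq> - m / k"
    by (rule eventually_neq_at_within)
  then show ?thesis
    by eventually_elim (use that in \<open>auto simp: field_simps add_eq_0_iff\<close>)
qed

lemma eventually_quadratic_nonzero: "\<forall>\<^sub>F t in at (0::real). t * t + m * t + k \<noteq> 0"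
proof (cases "k = 0")
  case True
  have "\<forall>\<^sub>F t in at 0. t \<noteq> - m" "\<forall>\<^sub>F t in at 0. t \<noteq> (0::real)"
    by (rule eventually_neq_at_within)+
  then show ?thesis
    by eventually_elim (use True in \<open>auto simp: distrib_right[symmetric] add_eq_0_iff\<close>)
next
  case False
  have "((\<lambda>t. t * t + m * t + k) \<longlongrightarrow> 0 * 0 + m * 0 + k) (at 0)"
    by (intro tendsto_intros)
  then show ?thesis
    using False by (intro tendsto_imp_eventually_ne) auto
qed

lemma rigid_cubic_law:
  assumes "rigid_law (cubic_law a b c)"
  shows "isomorphic_laws (cubic_law a b c) mu1 \<or> isomorphic_laws (cubic_law a b c) mu2"
proof -
  obtain r where r: "r ^ 3 = a * r\<^sup>2 + b * r + c"
    by (rule real_cubic_root)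
  \<comment> \<open>Division by the root: the cubic is
    \<open>(X - r) (X^2 - p X - q)\<close>.\<close>
  define p q where "p = a - r" "q = b + r * (a - r)"
  \<comment> \<open>The law of \<open>(X - (r + t)) (X^2 - p X - (q + t))\<close>. Shifting both
    \<open>r\<close> and \<open>q\<close> makes each degeneracy condition a nonzero polynomial in
    \<open>t\<close>, so small \<open>t \<noteq> 0\<close> avoid them all.\<close>
  define \<nu> where "\<nu> t = cubic_law (r + t + p) (q + t - (r + t) * p) (- ((r + t) * (q + t)))" for t
  have \<nu>0: "\<nu> 0 = cubic_law a b c"
    using r unfolding \<nu>_def p_q_def
    by (intro arg_cong3[of _ _ _ _ _ _ cubic_law]) (simp_all add: eval_nat_numeral algebra_simps)
  have "isCont (\<lambda>t. \<nu> t x y) 0" for x y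
    unfolding isCont_def \<nu>_def by (intro tendsto_cubic_law tendsto_intros)
  then have "\<forall>\<^sub>F t in at 0. isomorphic_laws (\<nu> t) (\<nu> 0)"
    using assms \<nu>0 by (intro rigid_law_eventually_isomorphic) (simp_all add: \<nu>_def cubic_law_comm_assoc)
  moreover have "\<forall>\<^sub>F t in at 0. r + 1 * t \<noteq> 0" "\<forall>\<^sub>F t in at 0. q + 1 * t \<noteq> 0"
    "\<forall>\<^sub>F t in at 0. (p\<^sup>2 + 4 * q) + 4 * t \<noteq> 0"
    by (intro eventually_linear_nonzero; simp)+
  moreover have "\<forall>\<^sub>F t in at 0. t * t + (2 * r - p - 1) * t + (r * r - p * r - q) \<noteq> 0"
    by (rule eventually_quadratic_nonzero)
  ultimately have "\<forall>\<^sub>F t in at 0. isomorphic_laws (\<nu> t) (\<nu> 0) \<and> r + t \<noteq> 0 \<and> q + t \<noteq> 0 \<and>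
      p\<^sup>2 + 4 * (q + t) \<noteq> 0 \<and> (r + t)\<^sup>2 - p * (r + t) - (q + t) \<noteq> 0"
    by eventually_elim (simp add: power2_eq_square algebra_simps)
  then obtain t where t: "isomorphic_laws (\<nu> t) (\<nu> 0)" "r + t \<noteq> 0" "q + t \<noteq> 0"
    "p\<^sup>2 + 4 * (q + t) \<noteq> 0" "(r + t)\<^sup>2 - p * (r + t) - (q + t) \<noteq> 0"
    using eventually_happens[of _ "at (0::real)"] by force
  from t(4) have "isomorphic_laws (\<nu> t) mu1 \<or> isomorphic_laws (\<nu> t) mu2"
    unfolding \<nu>_def using separable_cubic_law[OF t(2-5) refl refl refl]
    by (metis linorder_neqE_linordered_idom)
  then show ?thesis
    using t(1) isomorphic_laws_sym isomorphic_laws_trans unfolding \<nu>0 by blast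
qed

section \<open>Laws with a generator\<close>

locale comm_assoc_law3 =
  fixes mult :: "real^3 \<Rightarrow> real^3 \<Rightarrow> real^3" (infixl "\<odot>" 70)
  assumes comm_assoc: "mult \<in> comm_assoc_laws"
begin

lemma bilinear: "bilinear mult"
  and comm: "x \<odot> y = y \<odot> x"
  and assoc: "(x \<odot> y) \<odot> z = x \<odot> (y \<odot> z)"
  using comm_assoc unfolding comm_assoc_laws_def by auto

lemma left_comm: "x \<odot> (y \<odot> z) = y \<odot> (x \<odot> z)"
  by (metis assoc comm)

lemmas bilinear_simps =
  bilinear_ladd[OF bilinear] bilinear_radd[OF bilinear] bilinear_lmul[OF bilinear]
  bilinear_rmul[OF bilinear] bilinear_lsub[OF bilinear] bilinear_rsub[OF bilinear]
  bilinear_lneg[OF bilinear] bilinear_rneg[OF bilinear]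
  bilinear_lzero[OF bilinear] bilinear_rzero[OF bilinear]

text \<open>Send \<open>X, X^2, X^3\<close> to \<open>x, x^2, x^3\<close>. The relation for
  \<open>x^4\<close> determines the fifth and sixth powers too, hence all products of basis
  vectors.\<close>

lemma cubic_law_iso:
  assumes "triple x (x \<odot> x) (x \<odot> (x \<odot> x)) \<noteq> 0"
    and x4: "x \<odot> (x \<odot> (x \<odot> x)) = a *\<^sub>R (x \<odot> (x \<odot> x)) + b *\<^sub>R (x \<odot> x) + c *\<^sub>R x"
  shows "isomorphic_laws (cubic_law a b c) mult"
proof -
  define x2 x3 where x23: "x2 = x \<odot> x" "x3 = x \<odot> x2"
  have t: "x \<odot> x = x2" "x \<odot> x2 = x3" "x2 \<odot> x = x3" "x \<odot> x3 = a *\<^sub>R x3 + b *\<^sub>R x2 + c *\<^sub>R x"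
    using x4 by (simp_all add: x23 comm)
  have t': "x3 \<odot> x = a *\<^sub>R x3 + b *\<^sub>R x2 + c *\<^sub>R x" "x2 \<odot> x2 = a *\<^sub>R x3 + b *\<^sub>R x2 + c *\<^sub>R x"
    using t by (simp_all add: comm[of x3 x]) (metis assoc t(1,2))
  have s: "x2 \<odot> x3 = x \<odot> (x \<odot> x3)" "x3 \<odot> x2 = x \<odot> (x \<odot> x3)" "x3 \<odot> x3 = x \<odot> (x \<odot> (x \<odot> x3))"
    unfolding x23 by (metis assoc, metis assoc comm, metis assoc)
  let ?f = "\<lambda>y::real^3. y$1 *\<^sub>R x + y$2 *\<^sub>R x2 + y$3 *\<^sub>R x3"
  have "?f (cubic_law a b c y z) = ?f y \<odot> ?f z" for y z
    by (simp add: bilinear_simps t t' s cubic_law_def Let_def) (simp add: vec_eq_iff algebra_simps)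
  moreover have "linear ?f" "bij ?f"
    using assms(1) by (intro triple_basis_bij; simp add: x23)+
  ultimately show ?thesis
    unfolding isomorphic_laws_def by (intro exI[of _ ?f]) blast
qed

lemma rigid_generated:
  assumes "rigid_law mult" "triple x (x \<odot> x) (x \<odot> (x \<odot> x)) \<noteq> 0"
  shows "isomorphic_laws mult mu1 \<or> isomorphic_laws mult mu2"
proof -
  obtain c b a where
    "x \<odot> (x \<odot> (x \<odot> x)) = c *\<^sub>R x + b *\<^sub>R (x \<odot> x) + a *\<^sub>R (x \<odot> (x \<odot> x))"
    by (rule triple_basis_expansion[OF assms(2)])
  then have iso: "isomorphic_laws (cubic_law a b c) mult"
    by (intro cubic_law_iso[OF assms(2)]) (simp add: ac_simps)
  then have "rigid_law (cubic_law a b c)"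
    using rigid_law_cong[OF assms(1) isomorphic_laws_sym cubic_law_comm_assoc] by blast
  then show ?thesis
    using rigid_cubic_law iso isomorphic_laws_sym isomorphic_laws_trans by blast
qed

end

section \<open>Rigidity of the two semisimple laws\<close>

text \<open>Neighbourhoods are taken in the whole coordinate space, where a point need not come from
  a law; hence the quantifier over \<open>\<rho>\<close>.\<close>

lemma openin_law_topologyI:
  fixes S :: "(real^'n \<Rightarrow> real^'n \<Rightarrow> real^'n) set"
  assumes "S \<subseteq> comm_assoc_laws"
    and "\<And>\<nu>. \<nu> \<in> S \<Longrightarrow> \<forall>\<^sub>F C in nhds (structure_constants \<nu>).
      \<forall>\<rho>\<in>comm_assoc_laws. structure_constants \<rho> = C \<longrightarrow> \<rho> \<in> S"
  shows "openin law_topology S"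
proof -
  let ?W = "\<Union>{U. open U \<and> structure_constants -` U \<inter> comm_assoc_laws \<subseteq> S}"
  have "S \<subseteq> structure_constants -` ?W \<inter> comm_assoc_laws"
  proof
    fix \<nu> assume "\<nu> \<in> S"
    then obtain U where "open U" "structure_constants \<nu> \<in> U"
      "\<forall>C\<in>U. \<forall>\<rho>\<in>comm_assoc_laws. structure_constants \<rho> = C \<longrightarrow> \<rho> \<in> S"
      using assms(2)[OF \<open>\<nu> \<in> S\<close>] unfolding eventually_nhds by blast
    then show "\<nu> \<in> structure_constants -` ?W \<inter> comm_assoc_laws"
      using \<open>\<nu> \<in> S\<close> assms(1) by blast
  qed
  then have "S = structure_constants -` ?W \<inter> comm_assoc_laws"
    by blast
  moreover have "open ?W"
    by blast
  ultimately show ?thesis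
    unfolding law_topology_def openin_pullback_topology by auto
qed

text \<open>The generator is the image of \<open>X\<close>, the first basis vector.\<close>

lemma generator_of_cubic_law_iso:
  fixes \<nu> :: "real^3 \<Rightarrow> real^3 \<Rightarrow> real^3"
  assumes "isomorphic_laws (cubic_law a b c) \<nu>"
  obtains x where "triple x (\<nu> x x) (\<nu> x (\<nu> x x)) \<noteq> 0"
    and "\<nu> x (\<nu> x (\<nu> x x)) = a *\<^sub>R \<nu> x (\<nu> x x) + b *\<^sub>R \<nu> x x + c *\<^sub>R x"
proof -
  obtain f where f: "linear f" "bij f" "\<And>x y. f (cubic_law a b c x y) = \<nu> (f x) (f y)"
    using assms unfolding isomorphic_laws_def by auto
  define e where "e k = (axis k 1 :: real^3)" for k
  have e: "cubic_law a b c (e 1) (e 1) = e 2" "cubic_law a b c (e 1) (e 2) = e 3"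
    "cubic_law a b c (e 1) (e 3) = a *\<^sub>R e 3 + b *\<^sub>R e 2 + c *\<^sub>R e 1"
    by (simp_all add: e_def cubic_law_def Let_def vec_eq_iff forall_3 axis_def)
  define x where "x = f (e 1)"
  have x: "\<nu> x x = f (e 2)" "\<nu> x (f (e 2)) = f (e 3)"
    "\<nu> x (f (e 3)) = a *\<^sub>R f (e 3) + b *\<^sub>R f (e 2) + c *\<^sub>R f (e 1)"
    unfolding x_def f(3)[symmetric] e using f(1) by (simp_all add: linear_add linear_scale)
  \<comment> \<open>The images are rows in \<open>triple\<close> but columns in
    \<open>matrix f\<close>.\<close>
  have "triple (f (e 1)) (f (e 2)) (f (e 3)) = det (transpose (matrix f))"
    by (simp add: triple_def det_3 transpose_def matrix_def e_def)
  moreover have "det (matrix f) \<noteq> 0"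
    using f(1,2) det_nz_iff_inj bij_is_inj by blast
  ultimately show ?thesis
    using that[of x] x by (simp add: x_def)
qed

text \<open>Each law in the orbit has a generator with coefficients in \<open>U\<close>. For nearby
  laws the same vector generates and its coefficients stay in \<open>U\<close>, so these laws are
  again isomorphic to \<open>\<mu>\<close>.\<close>

lemma rigid_law_of_open_cubics:
  fixes \<mu> :: "real^3 \<Rightarrow> real^3 \<Rightarrow> real^3"
  assumes "open U" "(a, b, c) \<in> U" "\<mu> \<in> comm_assoc_laws"
    and iso: "\<And>a b c. (a, b, c) \<in> U \<Longrightarrow> isomorphic_laws (cubic_law a b c) \<mu>"
  shows "rigid_law \<mu>"
proof -
  have laws: "law_orbit \<mu> \<subseteq> comm_assoc_laws"
    using assms(3) isomorphic_comm_assoc unfolding law_orbit_eq by blast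
  have "openin law_topology (law_orbit \<mu>)"
  proof (rule openin_law_topologyI[OF laws])
    fix \<nu> assume "\<nu> \<in> law_orbit \<mu>"
    then have "isomorphic_laws (cubic_law a b c) \<nu>"
      using iso[OF assms(2)] isomorphic_laws_trans isomorphic_laws_sym unfolding law_orbit_eq by blast
    then obtain x where x: "triple x (\<nu> x x) (\<nu> x (\<nu> x x)) \<noteq> 0"
      "\<nu> x (\<nu> x (\<nu> x x)) = a *\<^sub>R \<nu> x (\<nu> x x) + b *\<^sub>R \<nu> x x + c *\<^sub>R x"
      by (rule generator_of_cubic_law_iso)
    \<comment> \<open>\<open>pr\<close> rebuilds a product from coordinates and is also defined
      where \<open>C\<close> is not associative, so limits can be taken in the whole space.\<close>
    define pr where "pr C = law_of_table (\<lambda>i j. C $ i $ j)" for C :: "real^3^3^3"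
    have pr: "pr (structure_constants \<rho>) = \<rho>" if "\<rho> \<in> comm_assoc_laws" for \<rho>
      using that law_of_structure_constants[of \<rho>] by (auto simp: pr_def comm_assoc_laws_def fun_eq_iff)
    define X2 X3 X4 where X: "X2 C = pr C x x" "X3 C = pr C x (X2 C)" "X4 C = pr C x (X3 C)" for C
    define D where "D C = triple x (X2 C) (X3 C)" for C
    \<comment> \<open>Cramer coefficients of \<open>x^4\<close> on \<open>x^3\<close>,
      \<open>x^2\<close> and \<open>x\<close>, in this order.\<close>
    define F where "F C = (triple x (X2 C) (X4 C) / D C, triple x (X4 C) (X3 C) / D C,
      triple (X4 C) (X2 C) (X3 C) / D C)" for C
    let ?C0 = "structure_constants \<nu>"
    have pr_lim: "((\<lambda>C. pr C x (g C)) \<longlongrightarrow> pr ?C0 x (g ?C0)) (nhds ?C0)"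
      if "(g \<longlongrightarrow> g ?C0) (nhds ?C0)" for g
      unfolding pr_def law_of_table_def by (intro tendsto_intros that filterlim_ident)
    have X_lim: "(X2 \<longlongrightarrow> X2 ?C0) (nhds ?C0)" "(X3 \<longlongrightarrow> X3 ?C0) (nhds ?C0)"
      "(X4 \<longlongrightarrow> X4 ?C0) (nhds ?C0)"
      unfolding X by (intro pr_lim tendsto_const)+
    have X_\<nu>: "X2 ?C0 = \<nu> x x" "X3 ?C0 = \<nu> x (\<nu> x x)" "X4 ?C0 = \<nu> x (\<nu> x (\<nu> x x))"
      using pr[of \<nu>] \<open>\<nu> \<in> law_orbit \<mu>\<close> laws by (auto simp: X)
    have D0: "D ?C0 \<noteq> 0"
      using x(1) by (simp add: D_def X_\<nu>)
    have "triple u v (a *\<^sub>R w + b *\<^sub>R v + c *\<^sub>R u) = a * triple u v w"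
      "triple u (a *\<^sub>R w + b *\<^sub>R v + c *\<^sub>R u) w = b * triple u v w"
      "triple (a *\<^sub>R w + b *\<^sub>R v + c *\<^sub>R u) v w = c * triple u v w" for u v w
      by (simp_all add: triple_expand algebra_simps)
    then have F0: "F ?C0 = (a, b, c)"
      using x(1) by (simp add: F_def D_def X_\<nu> x(2))
    \<comment> \<open>\<open>x\<close> still generates the laws near \<open>\<nu>\<close>, with coefficients given by Cramer's rule.\<close>
    have "(D \<longlongrightarrow> D ?C0) (nhds ?C0)"
      unfolding D_def triple_expand by (intro tendsto_intros X_lim)
    moreover from this have "(F \<longlongrightarrow> F ?C0) (nhds ?C0)"
      unfolding F_def triple_expand by (intro tendsto_intros X_lim D0)
    ultimately have "\<forall>\<^sub>F C in nhds ?C0. D C \<noteq> 0" "\<forall>\<^sub>F C in nhds ?C0. F C \<in> U"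
      using D0 assms(1,2) F0 by (auto intro: tendsto_imp_eventually_ne topological_tendstoD)
    then show "\<forall>\<^sub>F C in nhds ?C0. \<forall>\<rho>\<in>comm_assoc_laws. structure_constants \<rho> = C \<longrightarrow> \<rho> \<in> law_orbit \<mu>"
    proof eventually_elim
      case (elim C)
      show ?case
      proof (intro ballI impI)
        fix \<rho> assume \<rho>: "\<rho> \<in> comm_assoc_laws" "structure_constants \<rho> = C"
        interpret comm_assoc_law3 \<rho>
          using \<rho>(1) by unfold_locales
        have prC: "pr C = \<rho>"
          using pr \<rho> by blast
        obtain a' b' c' where F: "F C = (a', b', c')"
          by (cases "F C") auto
        have "X4 C = (1 / D C) *\<^sub>R (D C *\<^sub>R X4 C)"
          using elim by simp
        also have "\<dots> = a' *\<^sub>R X3 C + b' *\<^sub>R X2 C + c' *\<^sub>R x"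
          using F elim unfolding D_def triple_cramer[of x "X2 C" "X3 C" "X4 C"] F_def
          by (auto simp: scaleR_right_distrib)
        finally have "isomorphic_laws (cubic_law a' b' c') \<rho>"
          using elim by (intro cubic_law_iso) (simp_all add: X D_def prC)
        then show "\<rho> \<in> law_orbit \<mu>"
          using iso[of a' b' c'] elim F isomorphic_laws_sym isomorphic_laws_trans
          unfolding law_orbit_eq by force
      qed
    qed
  qed
  then show ?thesis
    using assms(3) by (simp add: rigid_law_def)
qed

text \<open>Alternating signs of the cubic at four positive points form an open condition and force
  three distinct positive roots.\<close>

lemma rigid_mu1: "rigid_law mu1"
proof -
  define q :: "real \<Rightarrow> real \<times> real \<times> real \<Rightarrow> real"
    where "q s v = s ^ 3 - fst v * s\<^sup>2 - fst (snd v) * s - snd (snd v)" for s v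
  let ?U = "{v. q (1/2) v < 0 \<and> 0 < q (3/2) v \<and> q (5/2) v < 0 \<and> 0 < q (7/2) v}"
  have U: "open ?U"
    unfolding q_def
    by (intro open_Collect_conj open_Collect_less) (intro continuous_intros)+
  \<comment> \<open>The cubic \<open>(X - 1) (X - 2) (X - 3)\<close>.\<close>
  have mem: "(6, - 11, 6) \<in> ?U"
    by (simp add: q_def eval_nat_numeral)
  have iso: "isomorphic_laws (cubic_law a b c) mu1" if "(a, b, c) \<in> ?U" for a b c
  proof -
    have cont: "isCont (\<lambda>s. q s (a, b, c)) s" for s
      unfolding q_def by (auto intro!: continuous_intros)
    have sgn: "q (1/2) (a, b, c) < 0" "0 < q (3/2) (a, b, c)" "q (5/2) (a, b, c) < 0"
      "0 < q (7/2) (a, b, c)"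
      using that by blast+
    obtain r where r: "1/2 \<le> r" "r \<le> 3/2" "q r (a, b, c) = 0"
      using IVT[of "\<lambda>s. q s (a, b, c)" "1/2" 0 "3/2"] sgn cont by (auto simp: less_imp_le)
    obtain s where s: "3/2 \<le> s" "s \<le> 5/2" "q s (a, b, c) = 0"
      using IVT2[of "\<lambda>s. q s (a, b, c)" "5/2" 0 "3/2"] sgn cont by (auto simp: less_imp_le)
    obtain t where t: "5/2 \<le> t" "t \<le> 7/2" "q t (a, b, c) = 0"
      using IVT[of "\<lambda>s. q s (a, b, c)" "5/2" 0 "7/2"] sgn cont by (auto simp: less_imp_le)
    have "r \<noteq> 3/2" "s \<noteq> 3/2" "s \<noteq> 5/2" "t \<noteq> 5/2"
      using sgn r(3) s(3) t(3) by (metis less_irrefl)+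
    moreover have "u ^ 3 = a * u\<^sup>2 + b * u + c" if "q u (a, b, c) = 0" for u
      using that unfolding q_def by simp
    ultimately show ?thesis
      using r s t by (intro cubic_law_iso_mu1[of r s t]) auto
  qed
  show ?thesis
    by (rule rigid_law_of_open_cubics[OF U mem mu1_comm_assoc iso])
qed

lemma rigid_mu2: "rigid_law mu2"
proof -
  \<comment> \<open>The derivative of \<open>X\<^sup>3 - a X\<^sup>2 - b X - c\<close> has no real zero, so that there is only one real root.\<close>
  let ?U = "{v::real \<times> real \<times> real. (fst v)\<^sup>2 + 3 * fst (snd v) < 0 \<and> snd (snd v) \<noteq> 0}"
  have U: "open ?U"
    by (intro open_Collect_conj open_Collect_less open_Collect_neq) (intro continuous_intros)+
  \<comment> \<open>The cubic \<open>(X - 1) (X^2 + 1)\<close>.\<close>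
  have mem: "(1, - 1, 1) \<in> ?U"
    by simp
  have iso: "isomorphic_laws (cubic_law a b c) mu2" if "(a, b, c) \<in> ?U" for a b c
  proof -
    have neg: "a\<^sup>2 + 3 * b < 0" and "c \<noteq> 0"
      using that by auto
    obtain r where r: "r ^ 3 = a * r\<^sup>2 + b * r + c"
      by (rule real_cubic_root)
    define p q where "p = a - r" "q = b + r * p"
    have c: "c = - (r * q)"
      using r by (simp add: p_q_def eval_nat_numeral algebra_simps)
    \<comment> \<open>The square bounds the discriminant of the cofactor
      \<open>X^2 - p X - q\<close>, which is therefore negative. So the cofactor has no real zero,
      in particular not \<open>r\<close>.\<close>
    have "4 * (a\<^sup>2 + 3 * b) - 3 * (p\<^sup>2 + 4 * q) = (3 * r - a)\<^sup>2"
      by (simp add: p_q_def power2_eq_square algebra_simps)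
    then have "0 \<le> 4 * (a\<^sup>2 + 3 * b) - 3 * (p\<^sup>2 + 4 * q)"
      by (metis zero_le_power2)
    then have disc: "p\<^sup>2 + 4 * q < 0"
      using neg by argo
    have "4 * (r\<^sup>2 - p * r - q) + (p\<^sup>2 + 4 * q) = (2 * r - p)\<^sup>2"
      by (simp add: power2_eq_square algebra_simps)
    then have "0 \<le> 4 * (r\<^sup>2 - p * r - q) + (p\<^sup>2 + 4 * q)"
      by (metis zero_le_power2)
    then have "r\<^sup>2 - p * r - q \<noteq> 0"
      using disc by argo
    then show ?thesis
      using \<open>c \<noteq> 0\<close> disc c
      by (intro separable_cubic_law(2)[of r q p]) (auto simp: p_q_def)
  qed
  show ?thesis
    by (rule rigid_law_of_open_cubics[OF U mem mu2_comm_assoc iso])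
qed

section \<open>Laws that are not generated by one element\<close>

lemma triple_zero_dependent:
  assumes "triple p q r = 0"
  obtains a b c where "a \<noteq> 0 \<or> b \<noteq> 0 \<or> c \<noteq> 0" "a *\<^sub>R p + b *\<^sub>R q + c *\<^sub>R r = 0"
proof -
  let ?f = "\<lambda>x::real^3. x$1 *\<^sub>R p + x$2 *\<^sub>R q + x$3 *\<^sub>R r"
  have lin: "linear ?f"
    by (rule linearI) (simp_all add: algebra_simps)
  have "det (matrix ?f) = triple p q r"
    by (simp add: triple_expand det_3 matrix_def axis_def algebra_simps)
  then have "\<not> inj ?f"
    using assms det_nz_iff_inj[OF lin] by simp
  then obtain x where "?f x = 0" "x \<noteq> 0"
    unfolding linear_injective_0[OF lin] by blast
  then show ?thesis
    using that[of "x$1" "x$2" "x$3"] by (auto simp: vec_eq_iff forall_3)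
qed

lemma triple_zero_all_dependent:
  assumes "\<And>r. triple p q r = 0"
  obtains a b where "a \<noteq> 0 \<or> b \<noteq> 0" "a *\<^sub>R p + b *\<^sub>R q = 0"
proof -
  have minors: "p$2 * q$3 = p$3 * q$2" "p$1 * q$3 = p$3 * q$1" "p$1 * q$2 = p$2 * q$1"
    using assms[of "axis 1 1"] assms[of "axis 2 1"] assms[of "axis 3 1"]
    by (auto simp: triple_expand axis_def)
  show ?thesis
  proof (cases "p = 0")
    case True
    then show ?thesis using that[of 1 0] by simp
  next
    case False
    then obtain i where "p$i \<noteq> 0"
      by (auto simp: vec_eq_iff)
    moreover have "(q$i) *\<^sub>R p + (- (p$i)) *\<^sub>R q = 0"
      using exhaust_3[of i] minors by (auto simp: vec_eq_iff forall_3 mult.commute)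
    ultimately show ?thesis
      using that[of "q$i" "- (p$i)"] by simp
  qed
qed

context comm_assoc_law3
begin

text \<open>For a commutative product, associativity means that \<open>(x y) z\<close> is symmetric
  in \<open>x\<close> and \<open>z\<close>. \<open>cocycle\<close> is this symmetry at first order
  in \<open>t\<close>; the second-order term \<open>f x * f y * f z * f w\<close> times
  \<open>w\<close> is symmetric by itself.\<close>

lemma deformation_comm_assoc:
  fixes f :: "real^3 \<Rightarrow> real"
  assumes f: "linear f"
    and cocycle: "\<And>x y z. (f x * f y) *\<^sub>R (w \<odot> z) + (f (x \<odot> y) * f z) *\<^sub>R w =
      (f z * f y) *\<^sub>R (w \<odot> x) + (f (z \<odot> y) * f x) *\<^sub>R w"
  shows "(\<lambda>x y. x \<odot> y + (t * f x * f y) *\<^sub>R w) \<in> comm_assoc_laws"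
proof (rule comm_assoc_lawsI)
  note f_simps = linear_add[OF f] linear_scale[OF f]
  show "(x + y) \<odot> z + (t * f (x + y) * f z) *\<^sub>R w =
    x \<odot> z + (t * f x * f z) *\<^sub>R w + (y \<odot> z + (t * f y * f z) *\<^sub>R w)" for x y z
    by (simp add: bilinear_simps f_simps algebra_simps)
  show "(r *\<^sub>R x) \<odot> y + (t * f (r *\<^sub>R x) * f y) *\<^sub>R w =
    r *\<^sub>R (x \<odot> y + (t * f x * f y) *\<^sub>R w)" for r x y
    by (simp add: bilinear_simps f_simps algebra_simps)
  show "x \<odot> y + (t * f x * f y) *\<^sub>R w = y \<odot> x + (t * f y * f x) *\<^sub>R w" for x y
    by (simp add: comm[of x y] mult_ac)
  show "(x \<odot> y + (t * f x * f y) *\<^sub>R w) \<odot> z + (t * f (x \<odot> y + (t * f x * f y) *\<^sub>R w) * f z) *\<^sub>R w =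
    x \<odot> (y \<odot> z + (t * f y * f z) *\<^sub>R w) + (t * f x * f (y \<odot> z + (t * f y * f z) *\<^sub>R w)) *\<^sub>R w"
    (is "?L = ?R") for x y z
  proof -
    have "?L = x \<odot> y \<odot> z + t *\<^sub>R ((f x * f y) *\<^sub>R (w \<odot> z) + (f (x \<odot> y) * f z) *\<^sub>R w)
        + (t * t * f x * f y * f z * f w) *\<^sub>R w"
      by (simp add: bilinear_simps f_simps) (simp add: vec_eq_iff algebra_simps)
    also have "\<dots> = ?R"
      unfolding cocycle[of x y z] assoc
      by (simp add: bilinear_simps f_simps comm[of z y] comm[of w x])
        (simp add: vec_eq_iff algebra_simps)
    finally show ?thesis .
  qed
qed

text \<open>Used to carry idempotents of a deformed law injectively back to the original
  one.\<close>

lemma rigid_deformation: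
  fixes f :: "real^3 \<Rightarrow> real"
  assumes "rigid_law mult" "linear f"
    and "\<And>x y z. (f x * f y) *\<^sub>R (w \<odot> z) + (f (x \<odot> y) * f z) *\<^sub>R w =
      (f z * f y) *\<^sub>R (w \<odot> x) + (f (z \<odot> y) * f x) *\<^sub>R w"
  obtains t g where "t \<noteq> 0" "inj g" "linear g"
    "\<And>x y. g (x \<odot> y + (t * f x * f y) *\<^sub>R w) = g x \<odot> g y"
proof -
  define \<nu> where "\<nu> = (\<lambda>t x y. x \<odot> y + (t * f x * f y) *\<^sub>R w)"
  have \<nu>0: "\<nu> 0 = mult"
    by (simp add: \<nu>_def fun_eq_iff)
  have "\<forall>\<^sub>F t in at 0. isomorphic_laws (\<nu> t) (\<nu> 0)"
  proof (rule rigid_law_eventually_isomorphic)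
    show "\<nu> t \<in> comm_assoc_laws" for t
      unfolding \<nu>_def by (rule deformation_comm_assoc[OF assms(2,3)])
    show "isCont (\<lambda>t. \<nu> t x y) 0" for x y
      unfolding \<nu>_def by (intro continuous_intros)
  qed (simp add: \<nu>0 assms(1))
  moreover have "\<forall>\<^sub>F t in at 0. t \<noteq> (0::real)"
    by (rule eventually_neq_at_within)
  ultimately have "\<forall>\<^sub>F t in at 0. isomorphic_laws (\<nu> t) (\<nu> 0) \<and> t \<noteq> 0"
    by (rule eventually_conj)
  then obtain t where "isomorphic_laws (\<nu> t) mult" "t \<noteq> 0"
    unfolding \<nu>0 using eventually_happens[of _ "at (0::real)"] by force
  then show ?thesis
    using that unfolding isomorphic_laws_def \<nu>_def bij_def by metis
qed

section \<open>Deformations of laws with vanishing cubes\<close>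

lemma triple_product_zero:
  assumes cube: "\<And>x. x \<odot> (x \<odot> x) = 0"
  shows "x \<odot> (y \<odot> z) = 0"
proof -
  have sq: "y \<odot> (x \<odot> x) = 0" for x y
  proof -
    have c: "y \<odot> x = x \<odot> y" "y \<odot> (x \<odot> y) = x \<odot> (y \<odot> y)" "y \<odot> (x \<odot> x) = x \<odot> (x \<odot> y)"
      by (metis comm, metis left_comm, metis comm left_comm)
    \<comment> \<open>Polarization: the cubes of \<open>x + y\<close> and \<open>x - y\<close>
      separate the two mixed terms. Polarizing the square afterwards gives all triple
      products.\<close>
    have "3 *\<^sub>R (x \<odot> (x \<odot> y)) + 3 *\<^sub>R (x \<odot> (y \<odot> y)) = (x + y) \<odot> ((x + y) \<odot> (x + y))"
      "3 *\<^sub>R (x \<odot> (y \<odot> y)) - 3 *\<^sub>R (x \<odot> (x \<odot> y)) = (x - y) \<odot> ((x - y) \<odot> (x - y))"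
      by (simp_all only: bilinear_simps c cube) (simp_all add: vec_eq_iff)
    then show ?thesis
      unfolding cube c by (auto simp: vec_eq_iff)
  qed
  have "2 *\<^sub>R (x \<odot> (y \<odot> z)) = x \<odot> ((y + z) \<odot> (y + z))"
    by (simp only: bilinear_simps sq comm[of z y]) (simp add: scaleR_2 sq)
  then show ?thesis
    by (simp add: sq)
qed

text \<open>Deforming along \<open>w\<close> creates a nonzero idempotent, but an idempotent equals
  its own cube and so must vanish in the original law.\<close>

lemma not_rigid_if_nilcube:
  assumes cube: "\<And>x. x \<odot> (x \<odot> x) = 0"
  shows "\<not> rigid_law mult"
proof
  assume rigid: "rigid_law mult"
  note zero = triple_product_zero[OF cube]
  \<comment> \<open>The form \<open>f z *\<^sub>R u\<close> makes one cocycle term symmetric,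
    vanishing of \<open>f\<close> on products kills the other, and \<open>f w = 1\<close> produces
    the idempotent. \<open>w\<close> is an element of nonzero square, or any nonzero vector if the
    product is zero.\<close>
  obtain w u and f :: "real^3 \<Rightarrow> real" where f: "linear f" "f w = 1" "\<And>z. w \<odot> z = f z *\<^sub>R u"
    "\<And>x y. f (x \<odot> y) = 0"
  proof (cases "\<exists>y. y \<odot> y \<noteq> 0")
    case True
    then obtain y where y: "y \<odot> y \<noteq> 0"
      by blast
    define u where "u = y \<odot> y"
    have u: "u \<noteq> 0" "y \<odot> u = 0"
      using y zero by (simp_all add: u_def)
    \<comment> \<open>Multiplication by \<open>y\<close> has square zero on a space of dimension 3,
      hence rank one.\<close>
    have multiple: "\<exists>c. y \<odot> z = c *\<^sub>R u" for z
    proof -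
      have "triple y u (y \<odot> z) = 0"
      proof (rule ccontr)
        assume T: "triple y u (y \<odot> z) \<noteq> 0"
        then obtain a b c where "z = a *\<^sub>R y + b *\<^sub>R u + c *\<^sub>R (y \<odot> z)"
          by (rule triple_basis_expansion)
        from arg_cong[OF this, of "\<lambda>v. y \<odot> v"] have "y \<odot> z = a *\<^sub>R u"
          by (simp add: bilinear_simps zero u_def)
        then show False
          using T by (simp add: triple_expand)
      qed
      then obtain a b c where abc: "a \<noteq> 0 \<or> b \<noteq> 0 \<or> c \<noteq> 0"
        "a *\<^sub>R y + b *\<^sub>R u + c *\<^sub>R (y \<odot> z) = 0"
        by (rule triple_zero_dependent)
      from arg_cong[OF abc(2), of "\<lambda>v. y \<odot> v"] have "a = 0"
        using u by (simp add: bilinear_simps zero u_def)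
      then have "c \<noteq> 0" "c *\<^sub>R (y \<odot> z) = (- b) *\<^sub>R u"
        using abc u(1) by (auto simp: add_eq_0_iff)
      then have "y \<odot> z = (1 / c) *\<^sub>R ((- b) *\<^sub>R u)"
        by (metis divide_self_if scaleR_one scaleR_scaleR times_divide_eq_left mult_1)
      then have "y \<odot> z = (- b / c) *\<^sub>R u"
        by simp
      then show ?thesis ..
    qed
    define f where "f z = ((y \<odot> z) \<bullet> u) / (u \<bullet> u)" for z
    have "linear f"
      by (rule linearI)
        (simp_all add: f_def bilinear_simps inner_add_left add_divide_distrib)
    moreover have "y \<odot> z = f z *\<^sub>R u" for z
      using multiple[of z] u(1) by (auto simp: f_def)
    moreover have "f y = 1" "f (x \<odot> z) = 0" for x z
      using u(1) by (simp_all add: f_def u_def[symmetric] zero)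
    ultimately show ?thesis
      using that by blast
  next
    case False
    have "x \<odot> y = 0" for x y
    proof -
      have "2 *\<^sub>R (x \<odot> y) = (x + y) \<odot> (x + y) - x \<odot> x - y \<odot> y"
        by (simp add: bilinear_simps comm[of y x] scaleR_2)
      then show ?thesis
        using False by simp
    qed
    then show ?thesis
      by (intro that[of "\<lambda>x. x $ 1" "axis 1 1" 0]) (auto intro: linearI)
  qed
  obtain t g where g: "t \<noteq> 0" "inj g" "linear g"
    "\<And>x y. g (x \<odot> y + (t * f x * f y) *\<^sub>R w) = g x \<odot> g y"
    by (rule rigid_deformation[OF rigid f(1), of w]) (auto simp: f mult_ac)
  \<comment> \<open>A nonzero idempotent of the deformed law.\<close>
  define e where "e = (1 / (t * t)) *\<^sub>R (w \<odot> w + t *\<^sub>R w)"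
  have fe: "f e = 1 / t"
    using g(1) by (simp add: e_def linear_add[OF f(1)] linear_scale[OF f(1)] f(2,4))
  have "e \<odot> e = (1 / (t * t)) *\<^sub>R (w \<odot> w)"
    using g(1) by (simp add: e_def bilinear_simps assoc zero)
  then have "e \<odot> e + (t * f e * f e) *\<^sub>R w = e"
    using g(1) by (simp add: fe) (simp add: e_def scaleR_right_distrib)
  then have "g e = g e \<odot> g e"
    using g(4)[of e e] by simp
  then have "g e = 0"
    using cube[of "g e"] by simp
  then have "e = 0"
    using g(2,3) linear_injective_0 by blast
  then show False
    using fe g(1) linear_0[OF f(1)] by simp
qed

text \<open>The deformation replaces \<open>p^2 = 0\<close> by \<open>p^2 = t p\<close>. It then has
  the idempotents \<open>e\<close> and \<open>p / t\<close>, while the original law has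
  \<open>e\<close> as its only nonzero one.\<close>

lemma not_rigid_if_square_zero_radical:
  assumes T: "triple e p q \<noteq> 0" and \<delta>: "\<delta> = 0 \<or> \<delta> = 1"
    and tab: "e \<odot> e = e" "e \<odot> p = \<delta> *\<^sub>R p" "e \<odot> q = \<delta> *\<^sub>R q" "p \<odot> p = 0" "p \<odot> q = 0" "q \<odot> q = 0"
  shows "\<not> rigid_law mult"
proof
  assume rigid: "rigid_law mult"
  define f where "f x = triple e x q / triple e p q" for x
  have f: "linear f"
    by (rule linearI) (simp_all add: f_def triple_expand add_divide_distrib[symmetric] algebra_simps)
  have f_basis: "f e = 0" "f p = 1" "f q = 0"
    using T by (simp_all add: f_def)
  note f_simps = linear_add[OF f] linear_scale[OF f] f_basis
  note tab' = tab comm[of p e] comm[of q e] comm[of q p]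
  have cocycle: "(f x * f y) *\<^sub>R (p \<odot> z) + (f (x \<odot> y) * f z) *\<^sub>R p =
      (f z * f y) *\<^sub>R (p \<odot> x) + (f (z \<odot> y) * f x) *\<^sub>R p" for x y z
  proof -
    obtain x0 x1 x2 y0 y1 y2 z0 z1 z2 where
      "x = x0 *\<^sub>R e + x1 *\<^sub>R p + x2 *\<^sub>R q" "y = y0 *\<^sub>R e + y1 *\<^sub>R p + y2 *\<^sub>R q"
      "z = z0 *\<^sub>R e + z1 *\<^sub>R p + z2 *\<^sub>R q"
      using triple_basis_expansion[OF T] by metis
    then show ?thesis
      by (simp add: bilinear_simps tab' f_simps) (simp add: vec_eq_iff algebra_simps)
  qed
  obtain t g where g: "t \<noteq> 0" "inj g" "linear g"
    "\<And>x y. g (x \<odot> y + (t * f x * f y) *\<^sub>R p) = g x \<odot> g y"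
    by (rule rigid_deformation[OF rigid f cocycle]) blast
  have unique: "a = e" if "a \<odot> a = a" "a \<noteq> 0" for a
  proof -
    obtain x y z where a: "a = x *\<^sub>R e + y *\<^sub>R p + z *\<^sub>R q"
      by (rule triple_basis_expansion[OF T])
    have eq: "(x * x - x) *\<^sub>R e + (2 * \<delta> * x * y - y) *\<^sub>R p + (2 * \<delta> * x * z - z) *\<^sub>R q = a \<odot> a - a"
      unfolding a by (simp add: bilinear_simps tab') (simp add: vec_eq_iff algebra_simps)
    \<comment> \<open>For \<open>x = 1\<close> the remaining factor \<open>2 * \<delta> - 1\<close>
      is 1 or -1, so \<open>y\<close> and \<open>z\<close> vanish; for \<open>x = 0\<close> they
      vanish at once.\<close>
    have "x * x - x = 0" "2 * \<delta> * x * y - y = 0" "2 * \<delta> * x * z - z = 0"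
      by (rule triple_independent[OF T eq[unfolded that(1) diff_self]])+
    moreover from this(1) have "x = 0 \<or> x = 1"
      by (simp add: right_diff_distrib[symmetric] algebra_simps)
    ultimately show ?thesis
      using \<delta> that(2) a by auto
  qed
  \<comment> \<open>An idempotent of the deformed law other than \<open>e\<close>.\<close>
  define v where "v = (1 / t) *\<^sub>R p"
  have "v \<odot> v + (t * f v * f v) *\<^sub>R p = v" "e \<odot> e + (t * f e * f e) *\<^sub>R p = e"
    using g(1) by (simp_all add: v_def bilinear_simps tab f_simps)
  then have "g v \<odot> g v = g v" "g e \<odot> g e = g e"
    using g(4)[of v v] g(4)[of e e] by simp_all
  moreover have "e \<noteq> 0" "v \<noteq> 0"
    using T g(1) by (auto simp: v_def triple_expand)
  then have "g v \<noteq> 0" "g e \<noteq> 0"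
    using g(2,3) linear_injective_0 by blast+
  ultimately have "g v = g e"
    using unique by metis
  then have "v = e"
    using g(2) by (simp add: inj_eq)
  then have "f v = f e"
    by simp
  then show False
    using g(1) by (simp add: v_def f_simps)
qed

section \<open>Idempotents in laws without generator\<close>

lemma idempotent_or_nilcube:
  assumes dep: "\<And>x. triple x (x \<odot> x) (x \<odot> (x \<odot> x)) = 0"
  obtains e where "e \<noteq> 0" "e \<odot> e = e" | "\<And>x. x \<odot> (x \<odot> x) = 0"
proof (cases "\<forall>x. x \<odot> (x \<odot> x) = 0")
  case False
  then obtain x where x: "x \<odot> (x \<odot> x) \<noteq> 0"
    by blast
  then have x0: "x \<noteq> 0" "x \<odot> x \<noteq> 0"
    by (auto simp: bilinear_simps)
  obtain a b c where abc: "a \<noteq> 0 \<or> b \<noteq> 0 \<or> c \<noteq> 0"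
    "a *\<^sub>R x + b *\<^sub>R (x \<odot> x) + c *\<^sub>R (x \<odot> (x \<odot> x)) = 0"
    by (rule triple_zero_dependent[OF dep])
  have idem: "\<exists>e. e \<noteq> 0 \<and> e \<odot> e = e"
    if y: "y \<noteq> 0" "y \<odot> y = r *\<^sub>R y" "r \<noteq> 0" for y r
    using y by (intro exI[of _ "(1 / r) *\<^sub>R y"]) (simp add: bilinear_simps)
  have "\<exists>e. e \<noteq> 0 \<and> e \<odot> e = e"
  proof (cases "c = 0")
    case True
    with abc x0 have "b \<noteq> 0" "a \<noteq> 0"
      by auto
    have "x \<odot> x = (1 / b) *\<^sub>R (b *\<^sub>R (x \<odot> x))"
      using \<open>b \<noteq> 0\<close> by simp
    also have "b *\<^sub>R (x \<odot> x) = (- a) *\<^sub>R x"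
      using abc(2) True by (simp add: add_eq_0_iff)
    finally show ?thesis
      using x0 \<open>a \<noteq> 0\<close> \<open>b \<noteq> 0\<close> by (intro idem[of x "- a / b"]) auto
  next
    case False
    define \<alpha> \<beta> where "\<alpha> = - a / c" "\<beta> = - b / c"
    have "x \<odot> (x \<odot> x) = (1 / c) *\<^sub>R (c *\<^sub>R (x \<odot> (x \<odot> x)))"
      using False by simp
    also have "c *\<^sub>R (x \<odot> (x \<odot> x)) = (- a) *\<^sub>R x + (- b) *\<^sub>R (x \<odot> x)"
      using abc(2) by (simp add: add_eq_0_iff algebra_simps)
    finally have x3: "x \<odot> (x \<odot> x) = \<alpha> *\<^sub>R x + \<beta> *\<^sub>R (x \<odot> x)"
      by (simp add: \<alpha>_\<beta>_def scaleR_right_distrib scaleR_right_diff_distrib)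
    show ?thesis
    proof (cases "\<alpha> = 0")
      case True
      \<comment> \<open>Here \<open>x^3 = \<beta> x^2\<close>, so \<open>x^2\<close> is a multiple
        of an idempotent.\<close>
      have "(x \<odot> x) \<odot> (x \<odot> x) = (\<beta> * \<beta>) *\<^sub>R (x \<odot> x)"
        using x3 True by (simp add: assoc bilinear_simps)
      moreover have "\<beta> \<noteq> 0"
        using x3 True x by auto
      ultimately show ?thesis
        using x0 by (intro idem[of "x \<odot> x" "\<beta> * \<beta>"]) auto
    next
      case False
      \<comment> \<open>Solving \<open>x^3 = \<alpha> x + \<beta> x^2\<close> for \<open>x\<close>
        gives \<open>e x = x\<close>. As \<open>e\<close> is a polynomial in \<open>x\<close>, it
        also fixes itself.\<close>
      define e where "e = (1 / \<alpha>) *\<^sub>R (x \<odot> x - \<beta> *\<^sub>R x)"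
      have ex: "e \<odot> x = x"
        using False by (simp add: e_def bilinear_simps assoc x3)
      have "e \<odot> e = (1 / \<alpha>) *\<^sub>R ((e \<odot> x) \<odot> x - \<beta> *\<^sub>R (e \<odot> x))"
        by (subst (2) e_def) (simp add: bilinear_simps assoc)
      also have "\<dots> = e"
        unfolding ex unfolding e_def ..
      finally have "e \<odot> e = e" .
      moreover have "e \<noteq> 0"
        using ex x0 by (auto simp: bilinear_simps)
      ultimately show ?thesis
        by blast
    qed
  qed
  then show ?thesis
    using that(1) by blast
qed (use that(2) in blast)

text \<open>The powers of \<open>e + s n\<close> are \<open>e + s^k n^k\<close>. Their determinant
  vanishes for every \<open>s\<close>, so its coefficient of \<open>s^3\<close> shows that
  \<open>e, n, n^2\<close> are dependent.\<close>

lemma square_of_orthogonal: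
  assumes dep: "\<And>x. triple x (x \<odot> x) (x \<odot> (x \<odot> x)) = 0"
    and e: "e \<noteq> 0" "e \<odot> e = e" and n: "n \<noteq> 0" "e \<odot> n = 0"
  obtains r where "n \<odot> n = r *\<^sub>R n"
proof -
  define n2 n3 where n23: "n2 = n \<odot> n" "n3 = n \<odot> n2"
  have en: "n \<odot> e = 0" "e \<odot> n2 = 0" "n2 \<odot> e = 0"
    using n(2) by (simp_all add: n23 comm[of _ e] bilinear_simps flip: assoc)
  have "triple (e + s *\<^sub>R n) (e + (s * s) *\<^sub>R n2) (e + (s * s * s) *\<^sub>R n3) = 0" for s
    using dep[of "e + s *\<^sub>R n"] by (simp add: bilinear_simps e n en n23[symmetric] mult.assoc)
  moreover have "triple (e + s *\<^sub>R n) (e + (s * s) *\<^sub>R n2) (e + (s * s * s) *\<^sub>R n3) =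
      s ^ 5 * triple e n2 n3 - s ^ 4 * triple e n n3 + s ^ 3 * triple e n n2
      + s ^ 6 * triple n n2 n3" for s
    by (simp add: triple_expand eval_nat_numeral algebra_simps)
  moreover have "triple n n2 n3 = 0"
    using dep[of n] by (simp add: n23)
  ultimately have p: "s ^ 5 * triple e n2 n3 - s ^ 4 * triple e n n3 + s ^ 3 * triple e n n2 = 0" for s
    by simp
  \<comment> \<open>Three values of \<open>s\<close> suffice for the three unknown
    coefficients.\<close>
  have "triple e n n2 = 0"
    using p[of 1] p[of "- 1"] p[of 2] by simp
  then obtain a b c where abc: "a \<noteq> 0 \<or> b \<noteq> 0 \<or> c \<noteq> 0" "a *\<^sub>R e + b *\<^sub>R n + c *\<^sub>R n2 = 0"
    by (rule triple_zero_dependent)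
  from arg_cong[OF abc(2), of "\<lambda>v. e \<odot> v"] have "a = 0"
    using e n(2) en by (simp add: bilinear_simps)
  with abc n(1) have "c \<noteq> 0"
    by auto
  have "n2 = (1 / c) *\<^sub>R (c *\<^sub>R n2)"
    using \<open>c \<noteq> 0\<close> by simp
  also have "c *\<^sub>R n2 = (- b) *\<^sub>R n"
    using abc(2) \<open>a = 0\<close> by (simp add: add_eq_0_iff)
  finally show ?thesis
    using that[of "- b / c"] by (simp add: n23)
qed

text \<open>Otherwise \<open>e, n, m\<close> is a basis with \<open>m^2\<close> a multiple of
  \<open>m\<close>, and \<open>e + 2 n + s m\<close> is a generator for suitable
  \<open>s\<close>.\<close>

lemma orthogonal_idempotents_complete:
  assumes dep: "\<And>x. triple x (x \<odot> x) (x \<odot> (x \<odot> x)) = 0"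
    and e: "e \<noteq> 0" "e \<odot> e = e" and n: "n \<noteq> 0" "n \<odot> n = n" "e \<odot> n = 0"
    and m: "e \<odot> m = 0" "n \<odot> m = 0"
  shows "m = 0"
proof (rule ccontr)
  assume "m \<noteq> 0"
  obtain r where mm: "m \<odot> m = r *\<^sub>R m"
    by (rule square_of_orthogonal[OF dep e \<open>m \<noteq> 0\<close> m(1)])
  have c: "n \<odot> e = 0" "m \<odot> e = 0" "m \<odot> n = 0"
    using n(3) m by (simp_all add: comm[of n e] comm[of m])
  have T: "triple e n m \<noteq> 0"
  proof
    assume "triple e n m = 0"
    then obtain x y z where xyz: "x \<noteq> 0 \<or> y \<noteq> 0 \<or> z \<noteq> 0" "x *\<^sub>R e + y *\<^sub>R n + z *\<^sub>R m = 0"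
      by (rule triple_zero_dependent)
    from arg_cong[OF xyz(2), of "\<lambda>v. e \<odot> v"] arg_cong[OF xyz(2), of "\<lambda>v. n \<odot> v"]
    have "x = 0" "y = 0"
      using e n m c by (simp_all add: bilinear_simps)
    then show False
      using xyz \<open>m \<noteq> 0\<close> by simp
  qed
  \<comment> \<open>The sign makes \<open>s * r \<le> 0\<close>, so the factors
    \<open>1 - s * r\<close> and \<open>2 - s * r\<close> of the determinant are positive.\<close>
  define s :: real where "s = (if r \<le> 0 then 1 else - 1)"
  define x where "x = e + 2 *\<^sub>R n + s *\<^sub>R m"
  have x2: "x \<odot> x = e + 4 *\<^sub>R n + (s * s * r) *\<^sub>R m"
    by (simp add: x_def bilinear_simps e n m c mm)
  have x3: "x \<odot> (x \<odot> x) = e + 8 *\<^sub>R n + (s * s * s * r * r) *\<^sub>R m"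
    unfolding x2 by (simp add: x_def bilinear_simps e n m c mm)
  have "triple x (x \<odot> x) (x \<odot> (x \<odot> x)) = 2 * s * (1 - s * r) * (2 - s * r) * triple e n m"
    unfolding x3 unfolding x2 by (simp add: x_def triple_expand algebra_simps)
  then have "s * (1 - s * r) * (2 - s * r) = 0"
    using dep[of x] T by simp
  then show False
    by (auto simp: s_def split: if_splits)
qed

text \<open>Peirce decomposition for \<open>e0\<close>. If its annihilator contains an element of
  nonzero square, a multiple of it is a second idempotent and the sum of the two is a unit; if the
  annihilator is 0, \<open>e0\<close> is a unit.\<close>

lemma unital_or_square_zero_complement:
  assumes dep: "\<And>x. triple x (x \<odot> x) (x \<odot> (x \<odot> x)) = 0"
    and e0: "e0 \<noteq> 0" "e0 \<odot> e0 = e0"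
  obtains e where "e \<noteq> 0" "\<And>x. e \<odot> x = x"
  | e n where "e \<noteq> 0" "e \<odot> e = e" "n \<noteq> 0" "e \<odot> n = 0" "\<And>x. e \<odot> x = 0 \<Longrightarrow> x \<odot> x = 0"
proof (cases "\<exists>n. e0 \<odot> n = 0 \<and> n \<odot> n \<noteq> 0")
  case True
  then obtain n where n: "e0 \<odot> n = 0" "n \<odot> n \<noteq> 0"
    by blast
  then have "n \<noteq> 0"
    by (auto simp: bilinear_simps)
  then obtain r where r: "n \<odot> n = r *\<^sub>R n"
    by (rule square_of_orthogonal[OF dep e0 _ n(1)])
  then have "r \<noteq> 0"
    using n(2) by auto
  define n' where "n' = (1 / r) *\<^sub>R n"
  have n': "n' \<noteq> 0" "n' \<odot> n' = n'" "e0 \<odot> n' = 0" "n' \<odot> e0 = 0"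
    using \<open>n \<noteq> 0\<close> \<open>r \<noteq> 0\<close> n(1) r by (simp_all add: n'_def bilinear_simps comm[of n e0])
  define e where "e = e0 + n'"
  have e: "e0 \<odot> e = e0" "n' \<odot> e = n'"
    using e0(2) n' by (simp_all add: e_def bilinear_simps)
  have "e \<odot> x = x" for x
  proof -
    have "e0 \<odot> (x - e \<odot> x) = 0" "n' \<odot> (x - e \<odot> x) = 0"
      using e by (simp_all add: bilinear_simps flip: assoc)
    then have "x - e \<odot> x = 0"
      by (rule orthogonal_idempotents_complete[OF dep e0 n'(1-3)])
    then show ?thesis
      by simp
  qed
  moreover have "e \<noteq> 0"
    using e(1) e0(1) by (auto simp: bilinear_simps)
  ultimately show ?thesis
    using that(1) by blast
next
  case False
  show ?thesis
  proof (cases "\<exists>n. n \<noteq> 0 \<and> e0 \<odot> n = 0")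
    case True
    then show ?thesis
      using that(2) e0 False by blast
  next
    case no: False
    have "e0 \<odot> x = x" for x
    proof -
      have "e0 \<odot> (x - e0 \<odot> x) = 0"
        using e0(2) by (simp add: bilinear_simps flip: assoc)
      then have "x - e0 \<odot> x = 0"
        using no by blast
      then show ?thesis
        by simp
    qed
    then show ?thesis
      using that(1) e0(1) by blast
  qed
qed

text \<open>Otherwise \<open>e, z, n\<close> is a basis. After completing the square to
  \<open>z'^2 = k e\<close>, some \<open>e + s z' + n\<close> would be a generator.\<close>

lemma fixed_by_idempotent:
  assumes dep: "\<And>x. triple x (x \<odot> x) (x \<odot> (x \<odot> x)) = 0"
    and e: "e \<noteq> 0" "e \<odot> e = e" and n: "n \<noteq> 0" "e \<odot> n = 0" "n \<odot> n = 0"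
    and z: "e \<odot> z = z"
  obtains c where "z = c *\<^sub>R e"
proof (rule ccontr)
  assume no: "\<not> thesis"
  have c: "n \<odot> e = 0" "z \<odot> e = z" "n \<odot> z = 0"
    using n z by (metis comm, metis comm, metis assoc comm bilinear_simps(9))
  have T: "triple e z n \<noteq> 0"
  proof
    assume "triple e z n = 0"
    then obtain x y w where xyw: "x \<noteq> 0 \<or> y \<noteq> 0 \<or> w \<noteq> 0" "x *\<^sub>R e + y *\<^sub>R z + w *\<^sub>R n = 0"
      by (rule triple_zero_dependent)
    from arg_cong[OF xyw(2), of "\<lambda>v. e \<odot> v"] have xy: "x *\<^sub>R e + y *\<^sub>R z = 0"
      using e z n by (simp add: bilinear_simps)
    have "y = 0"
    proof (rule ccontr)
      assume "y \<noteq> 0"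
      then have "z = (1 / y) *\<^sub>R (y *\<^sub>R z)"
        by simp
      also have "y *\<^sub>R z = (- x) *\<^sub>R e"
        using xy by (simp add: add_eq_0_iff)
      finally show False
        using no that[of "- x / y"] by simp
    qed
    then show False
      using xy xyw e(1) n(1) by auto
  qed
  obtain \<alpha> \<beta> \<gamma> where zz: "z \<odot> z = \<alpha> *\<^sub>R e + \<beta> *\<^sub>R z + \<gamma> *\<^sub>R n"
    by (rule triple_basis_expansion[OF T])
  have "e \<odot> (z \<odot> z) = z \<odot> z"
    using z by (simp flip: assoc)
  then have "\<gamma> *\<^sub>R n = 0"
    unfolding zz using e z n by (simp add: bilinear_simps)
  define z' where "z' = z - (\<beta> / 2) *\<^sub>R e"
  define k where "k = \<alpha> + \<beta> * \<beta> / 4"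
  have z': "e \<odot> z' = z'" "z' \<odot> e = z'" "n \<odot> z' = 0" "z' \<odot> n = 0"
    using e z n c by (simp_all add: z'_def bilinear_simps comm[of z n])
  have z'2: "z' \<odot> z' = k *\<^sub>R e"
    using e z c \<open>\<gamma> *\<^sub>R n = 0\<close> zz
    by (simp add: z'_def k_def bilinear_simps) (simp add: vec_eq_iff algebra_simps)
  have T': "triple e z' n \<noteq> 0"
    using T by (simp add: z'_def triple_expand algebra_simps)
  have "s * (1 - k * s * s)\<^sup>2 = 0" for s :: real
  proof -
    define x where "x = e + s *\<^sub>R z' + n"
    have x2: "x \<odot> x = (1 + k * s * s) *\<^sub>R e + (2 * s) *\<^sub>R z'"
      using e n c z' z'2 by (simp add: x_def bilinear_simps) (simp add: vec_eq_iff algebra_simps)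
    have x3: "x \<odot> (x \<odot> x) = (1 + 3 * k * s * s) *\<^sub>R e + (3 * s + k * s * s * s) *\<^sub>R z'"
      unfolding x2 using e n c z' z'2
      by (simp add: x_def bilinear_simps) (simp add: vec_eq_iff algebra_simps)
    have "triple x (x \<odot> x) (x \<odot> (x \<odot> x)) = s * (1 - k * s * s)\<^sup>2 * triple e z' n"
      unfolding x3 unfolding x2 by (simp add: x_def triple_expand power2_eq_square algebra_simps)
    then show ?thesis
      using dep[of x] T' by simp
  qed
  \<comment> \<open>These values would require both \<open>k = 1\<close> and
    \<open>4 * k = 1\<close>.\<close>
  from this[of 1] this[of 2] show False
    by simp
qed

lemma not_rigid_if_dependent_square_zero_complement:
  assumes dep: "\<And>x. triple x (x \<odot> x) (x \<odot> (x \<odot> x)) = 0"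
    and e: "e \<noteq> 0" "e \<odot> e = e" and n: "n \<noteq> 0" "e \<odot> n = 0"
    and sq: "\<And>x. e \<odot> x = 0 \<Longrightarrow> x \<odot> x = 0"
  shows "\<not> rigid_law mult"
proof -
  obtain r where T: "triple e n r \<noteq> 0"
  proof (rule ccontr)
    assume "\<not> thesis"
    then have "triple e n r = 0" for r
      using that by blast
    then obtain a b where ab: "a \<noteq> 0 \<or> b \<noteq> 0" "a *\<^sub>R e + b *\<^sub>R n = 0"
      by (rule triple_zero_all_dependent)
    from arg_cong[OF ab(2), of "\<lambda>v. e \<odot> v"] have "a = 0"
      using e n by (simp add: bilinear_simps)
    then show False
      using ab n(1) by simp
  qed
  have "e \<odot> (e \<odot> r) = e \<odot> r"
    using e(2) by (simp flip: assoc)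
  then obtain c where c: "e \<odot> r = c *\<^sub>R e"
    by (rule fixed_by_idempotent[OF dep e n sq[OF n(2)]])
  define q where "q = r - c *\<^sub>R e"
  have q: "e \<odot> q = 0"
    using e c by (simp add: q_def bilinear_simps)
  have "e \<odot> (n + q) = 0"
    using n q by (simp add: bilinear_simps)
  \<comment> \<open>Polarizing the vanishing squares on the annihilator of \<open>e\<close>.\<close>
  from sq[OF this] have "2 *\<^sub>R (n \<odot> q) = 0"
    using sq[OF n(2)] sq[OF q] by (simp only: bilinear_simps comm[of q n]) (simp add: scaleR_2)
  moreover have "triple e n q \<noteq> 0"
    using T by (simp add: q_def triple_expand algebra_simps)
  ultimately show ?thesis
    using e n q sq by (intro not_rigid_if_square_zero_radical[of e n q 0]) auto
qed

text \<open>Every element satisfies a quadratic equation over the unit. Completing squares gives a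
  basis \<open>e, p, q\<close> with \<open>p^2\<close> and \<open>q^2\<close> multiples of
  \<open>e\<close>, and associativity makes all products of \<open>p\<close> and \<open>q\<close>
  vanish.\<close>

lemma not_rigid_if_dependent_unital:
  assumes dep: "\<And>x. triple x (x \<odot> x) (x \<odot> (x \<odot> x)) = 0"
    and e: "e \<noteq> 0" "\<And>x. e \<odot> x = x"
  shows "\<not> rigid_law mult"
proof -
  have e': "x \<odot> e = x" for x
    by (metis e(2) comm)
  have quad: "triple e z (z \<odot> z) = 0" for z
  proof (rule ccontr)
    assume T: "triple e z (z \<odot> z) \<noteq> 0"
    obtain \<alpha> \<beta> \<gamma> where z3: "z \<odot> (z \<odot> z) = \<alpha> *\<^sub>R e + \<beta> *\<^sub>R z + \<gamma> *\<^sub>R (z \<odot> z)"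
      by (rule triple_basis_expansion[OF T])
    \<comment> \<open>Up to a nonzero factor this is the determinant for \<open>z + s e\<close>; a
      monic cubic cannot vanish for all \<open>s\<close>.\<close>
    have "s * s * s + \<gamma> * (s * s) - \<beta> * s + \<alpha> = 0" for s
    proof -
      define x where "x = z + s *\<^sub>R e"
      have x2: "x \<odot> x = z \<odot> z + (2 * s) *\<^sub>R z + (s * s) *\<^sub>R e"
        using e e' by (simp add: x_def bilinear_simps) (simp add: vec_eq_iff algebra_simps)
      have x3: "x \<odot> (x \<odot> x) = (\<gamma> + 3 * s) *\<^sub>R (z \<odot> z) + (\<beta> + 3 * s * s) *\<^sub>R z + (\<alpha> + s * s * s) *\<^sub>R e"
        unfolding x2 using e e' z3
        by (simp add: x_def bilinear_simps) (simp add: vec_eq_iff algebra_simps)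
      have "triple x (x \<odot> x) (x \<odot> (x \<odot> x)) =
          (s * s * s + \<gamma> * (s * s) - \<beta> * s + \<alpha>) * triple e z (z \<odot> z)"
        unfolding x3 unfolding x2 by (simp add: x_def triple_expand algebra_simps)
      then show ?thesis
        using dep[of x] T by simp
    qed
    from this[of 0] this[of 1] this[of "- 1"] this[of 2] show False
      by simp
  qed
  have complete_square: "\<exists>k c. (z + k *\<^sub>R e) \<odot> (z + k *\<^sub>R e) = c *\<^sub>R e" if T: "triple e z r \<noteq> 0" for z r
  proof -
    obtain x y w where xyw: "x \<noteq> 0 \<or> y \<noteq> 0 \<or> w \<noteq> 0" "x *\<^sub>R e + y *\<^sub>R z + w *\<^sub>R (z \<odot> z) = 0"
      by (rule triple_zero_dependent[OF quad])
    have "w \<noteq> 0"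
      using triple_independent[OF T, of x y 0] xyw by auto
    have "z \<odot> z = (1 / w) *\<^sub>R (w *\<^sub>R (z \<odot> z))"
      using \<open>w \<noteq> 0\<close> by simp
    also have "w *\<^sub>R (z \<odot> z) = (- x) *\<^sub>R e + (- y) *\<^sub>R z"
      using xyw(2) by (simp add: add_eq_0_iff algebra_simps)
    finally have zz: "z \<odot> z = (- x / w) *\<^sub>R e + (- y / w) *\<^sub>R z"
      by (simp add: scaleR_right_distrib scaleR_right_diff_distrib)
    define k where "k = y / (2 * w)"
    have "(z + k *\<^sub>R e) \<odot> (z + k *\<^sub>R e) = (k * k - x / w) *\<^sub>R e"
      using e e' \<open>w \<noteq> 0\<close>
      by (simp add: bilinear_simps zz) (simp add: k_def vec_eq_iff field_simps)
    then show ?thesis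
      by blast
  qed
  obtain r1 r2 where r12: "triple e r1 r2 \<noteq> 0"
  proof (rule ccontr)
    assume "\<not> thesis"
    then have "triple e r1 r2 = 0" for r1 r2
      using that by blast
    from this[of "axis 1 1" "axis 2 1"] this[of "axis 1 1" "axis 3 1"] this[of "axis 2 1" "axis 3 1"]
    have "e = 0"
      by (simp add: triple_expand axis_def vec_eq_iff forall_3)
    then show False
      using e(1) by simp
  qed
  obtain k1 a where p: "(r1 + k1 *\<^sub>R e) \<odot> (r1 + k1 *\<^sub>R e) = a *\<^sub>R e"
    using complete_square[OF r12] by blast
  have "triple e r2 r1 \<noteq> 0"
    using r12 by (simp add: triple_expand algebra_simps)
  then obtain k2 b where q: "(r2 + k2 *\<^sub>R e) \<odot> (r2 + k2 *\<^sub>R e) = b *\<^sub>R e"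
    using complete_square by blast
  define p q where "p = r1 + k1 *\<^sub>R e" "q = r2 + k2 *\<^sub>R e"
  note pp = p[folded p_q_def] and qq = q[folded p_q_def]
  have T: "triple e p q \<noteq> 0"
    using r12 by (simp add: p_q_def triple_expand algebra_simps)
  obtain x y w where pq: "p \<odot> q = x *\<^sub>R e + y *\<^sub>R p + w *\<^sub>R q"
    by (rule triple_basis_expansion[OF T])
  \<comment> \<open>\<open>e\<close>, \<open>p \<plusminus> q\<close> and \<open>(p \<plusminus> q)\<^sup>2\<close> are dependent, which forces \<open>p \<odot> q\<close> to be a multiple of \<open>e\<close>.\<close>
  have "triple e (p + q) ((p + q) \<odot> (p + q)) = 2 * (w - y) * triple e p q"
    "triple e (p - q) ((p - q) \<odot> (p - q)) = - 2 * (w + y) * triple e p q"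
    by (simp_all add: bilinear_simps pp qq pq comm[of q p] triple_expand algebra_simps)
  then have "w - y = 0" "w + y = 0"
    using T quad by simp_all
  then have yw: "y = 0" "w = 0"
    by simp_all
  \<comment> \<open>Computing \<open>p^2 q\<close> and \<open>p q^2\<close> also from
    \<open>p \<odot> q = x *\<^sub>R e\<close> gives linear relations between \<open>p\<close> and
    \<open>q\<close>.\<close>
  have "p \<odot> (p \<odot> q) = a *\<^sub>R q" "(p \<odot> q) \<odot> q = b *\<^sub>R p"
    using e e' by (simp_all add: pp qq bilinear_simps assoc) (simp add: pp bilinear_simps e flip: assoc)
  then have z: "0 *\<^sub>R e + x *\<^sub>R p + (- a) *\<^sub>R q = 0" "0 *\<^sub>R e + (- b) *\<^sub>R p + x *\<^sub>R q = 0"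
    unfolding pq yw using e e' by (simp_all add: bilinear_simps)
  have "x = 0" "a = 0" "b = 0"
    using triple_independent(2,3)[OF T z(1)] triple_independent(2)[OF T z(2)] by simp_all
  then show ?thesis
    using T e e' pp qq pq yw by (intro not_rigid_if_square_zero_radical[of e p q 1]) auto
qed

lemma rigid_classification:
  assumes "rigid_law mult"
  shows "isomorphic_laws mult mu1 \<or> isomorphic_laws mult mu2"
proof (cases "\<exists>x. triple x (x \<odot> x) (x \<odot> (x \<odot> x)) \<noteq> 0")
  case True
  then show ?thesis
    using rigid_generated[OF assms] by blast
next
  case False
  then have dep: "\<And>x. triple x (x \<odot> x) (x \<odot> (x \<odot> x)) = 0"
    by blast
  from dep have False
  proof (cases rule: idempotent_or_nilcube)
    case (1 e)
    with dep show False
      by (cases rule: unital_or_square_zero_complement)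
        (use dep assms not_rigid_if_dependent_unital
          not_rigid_if_dependent_square_zero_complement in blast)+
  qed (use not_rigid_if_nilcube assms in blast)
  then show ?thesis ..
qed

end

theorem theorem5p3:
  shows "mu1 \<in> comm_assoc_laws \<and> semisimple_law mu1 \<and>
    mu2 \<in> comm_assoc_laws \<and> semisimple_law mu2 \<and>
    rigid_affine_structure (affine_structure_of_law mu1) \<and>
    rigid_affine_structure (affine_structure_of_law mu2) \<and>
    \<not> affinely_equivalent (affine_structure_of_law mu1) (affine_structure_of_law mu2) \<and>
    (\<forall>\<Psi> :: real^3 \<Rightarrow> real^(3 option)^(3 option). rigid_affine_structure \<Psi> \<longrightarrow>
       affinely_equivalent \<Psi> (affine_structure_of_law mu1) \<or>
       affinely_equivalent \<Psi> (affine_structure_of_law mu2))"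
proof (intro conjI allI impI)
  have product: "affine_product (affine_structure_of_law mu1) = mu1"
    "affine_product (affine_structure_of_law mu2) = mu2"
    using mu1_comm_assoc mu2_comm_assoc
    by (simp_all add: affine_product_affine_structure_of_law comm_assoc_laws_def)
  show "\<not> affinely_equivalent (affine_structure_of_law mu1) (affine_structure_of_law mu2)"
    unfolding affinely_equivalent_def product by (rule not_isomorphic_mu1_mu2)
  fix \<Psi> :: "real^3 \<Rightarrow> real^(3 option)^(3 option)"
  assume "rigid_affine_structure \<Psi>"
  then have rigid: "rigid_law (affine_product \<Psi>)"
    by (simp add: rigid_affine_structure_def)
  then interpret comm_assoc_law3 "affine_product \<Psi>"
    by unfold_locales (simp add: rigid_law_def)
  show "affinely_equivalent \<Psi> (affine_structure_of_law mu1) \<or>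
      affinely_equivalent \<Psi> (affine_structure_of_law mu2)"
    unfolding affinely_equivalent_def product by (rule rigid_classification[OF rigid])
qed (simp_all add: mu1_comm_assoc mu2_comm_assoc semisimple_mu1 semisimple_mu2
    rigid_affine_structure_of_law rigid_mu1 rigid_mu2)

end
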